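(* Define $\epsilon_1$ to be the upper bound on the average decoding error probability of user 1 under treating-interference-as-noise (TIN) decoding. For the channel $y_1[j]=h_1(x_1[j]+x_2[j])+z_1[j]$, $j=1,\ldots,N_1$, with discrete signaling ($x_1[j]$ uniform over $\mathcal{X}_1$ and $x_2[j]$ uniform over $\mathcal{X}_{2,1}$), user 1's achievable rate by treating user 2's signals as interference is bounded by $$R_1\le I(X_1;Y_1)-\sqrt{\frac{V(X_1;Y_1)}{N_1}}\,Q^{-1}(\epsilon_1)+O\!\left(\frac{\log N_1}{N_1}\right),$$ where $$I(X_1;Y_1)=\log|\mathcal{X}_1|-\frac{1}{|\mathcal{X}_1|\cdot|\mathcal{X}_{2,1}|}\sum_{x_1\in\mathcal{X}_1}\sum_{x_{2,1}\in\mathcal{X}_{2,1}}\mathbb{E}_{Z_1}\big[\log L(x_1,x_{2,1},Z_1)\big],$$ $$V(X_1;Y_1)=\frac{1}{|\mathcal{X}_1|\cdot|\mathcal{X}_{2,1}|}\sum_{x_1\in\mathcal{X}_1}\sum_{x_{2,1}\in\mathcal{X}_{2,1}}\mathbb{E}_{Z_1}\big[(\log L(x_1,x_{2,1},Z_1))^2\big]-\Big(\frac{1}{|\mathcal{X}_1|\cdot|\mathcal{X}_{2,1}|}\sum_{x_1\in\mathcal{X}_1}\sum_{x_{2,1}\in\mathcal{X}_{2,1}}\mathbb{E}_{Z_1}\big[\log L(x_1,x_{2,1},Z_1)\big]\Big)^2,$$ with $Z_1\sim\mathcal{CN}(0,1)$ and $$L(x_1,x_{2,1},z)=\frac{\sum_{x_1'\in\mathcal{X}_1}\sum_{x_{2,1}'\in\mathcal{X}_{2,1}}e^{-|z+h_1(x_1-x_1'+x_{2,1}-x_{2,1}')|^2}}{\sum_{x_{2,1}'\in\mathcal{X}_{2,1}}e^{-|z+h_1(x_{2,1}-x_{2,1}')|^2}}.$$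 No ordering of the two users' channel gains is required for this statement.
   Context: All logarithms are base 2. $Q^{-1}$ is the inverse of $Q(x)=\int_x^\infty\frac{1}{\sqrt{2\pi}}e^{-t^2/2}\,dt$. $f(x)=O(g(x))$ means that there are $M\in\mathbb{R}^+$ and $x_0\in\mathbb{R}$ with $|f(x)|\le Mg(x)$ for all $x\ge x_0$. $\mathcal{CN}(0,1)$ is the complex Gaussian law with density $\frac1\pi e^{-|z|^2}$. Channel. A transmitter broadcasts to two users. User $i$'s packet $\boldsymbol{x}_i$ of coded symbols has length $N_i$, with $N_1\le N_2$, and $\boldsymbol{x}_1$ is superimposed on the first $N_1$ symbols of $\boldsymbol{x}_2$. The channel $h_i\in\mathbb{C}$ of user $i$ is constant over the transmission frame; the transmitter knows the channel magnitudes and the receivers have full channel state information. User 1 receives the $y_1[j]$ in the claim, where the $z_1[j]\sim\mathcal{CN}(0,1)$ are i.i.d. Signaling. $\mathcal{X}_1$ and $\mathcal{X}_{2,1}$ are the normalized constellations, after power assignment, of $\boldsymbol{x}_1$ and of the first $N_1$ symbols of $\boldsymbol{x}_2$. They come from regular quadrature amplitude modulation (QAM) constellations $\Lambda_1,\Lambda_{2,1}$ with zero mean, minimum distance 1 and integer modulation orders $m_1=\log|\Lambda_1|$, $m_{2,1}=\log|\Lambda_{2,1}|$. Let $P_1$ and $P_{2,1}$ be the powers of user 1's symbols and of user 2's first $N_1$ symbols, and $\eta_1=\sqrt{6/(2^{m_1+m_{2,1}}-1)}$. In the scheme with $|h_1|>|h_2|$, $\mathcal{X}_1=\eta_1\sqrt{P_1+P_{2,1}}\,\Lambda_1$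 and $\mathcal{X}_{2,1}=\eta_1\sqrt{2^{m_1}(P_1+P_{2,1})}\,\Lambda_{2,1}$, so that the superimposed constellation is a scaled regular QAM with $2^{m_1+m_{2,1}}$ points; when the channel order is reversed, the roles of $\Lambda_1$ and $\Lambda_{2,1}$ and of their modulation orders in this superposition are swapped. The scheme chooses the orders subject to $m_1+m_{2,1}\le\lfloor\log(1+6(P_1+P_{2,1})\max\{|h_1|^2,|h_2|^2\})\rfloor$ and $m_{2,1}\le\lfloor\log(6(P_1+P_{2,1})|h_2|^2)\rfloor$. For $j=1,\ldots,N_1$, the inputs $X_1[j]$ are i.i.d. uniform on $\mathcal{X}_1$ and the $X_2[j]$ are i.i.d. uniform on $\mathcal{X}_{2,1}$. TIN decoding (single-user decoding). User 1 decodes its own message from $y_1[1],\ldots,y_1[N_1]$ by treating user 2's signal as noise, without using user 2's codebook. If $M_1$ is user 1's codebook size, its rate is $R_1=\frac{\log M_1}{N_1}$. $I(X_1;Y_1)$ and $V(X_1;Y_1)$ are the mean and the variance of the per-symbol information density $i(X_1;Y_1)=\log\frac{\sum_{x_2\in\mathcal{X}_{2,1}}P(Y_1|X_1,x_2)}{\sum_{x_1\in\mathcal{X}_1}\sum_{x_2\in\mathcal{X}_{2,1}}P(Y_1|x_1,x_2)P(x_1)}$, where $P(y_1|x_1,x_2)=\frac1\pi e^{-|y_1-h_1(x_1+x_2)|^2}$ and $P(x_1)=\frac{1}{|\mathcal{X}_1|}$. *)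

theory Defs
  imports "HOL-Probability.Probability" "HOL-Library.Landau_Symbols"
begin

text \<open>\<^bold>\<open>Gaussian preliminaries\<close>\<close>

definition Qfun :: "real \<Rightarrow> real" where
  "Qfun x = (LINT t:{x..}|lborel. 1 / sqrt (2 * pi) * exp (- (t\<^sup>2 / 2)))"

text \<open>\<open>Qfun\<close> is a strictly decreasing bijection from the reals onto \<open>{0<..<1}\<close>, so
  \<open>Qinv e\<close> is meaningful exactly for \<open>0 < e < 1\<close>.\<close>

definition Qinv :: "real \<Rightarrow> real" where
  "Qinv = inv Qfun"

definition CN01 :: "complex measure" where
  "CN01 = density lborel (\<lambda>z. ennreal (1 / pi * exp (- (cmod z)\<^sup>2)))"


text \<open>\<^bold>\<open>Constellations\<close>\<close>

text \<open>\<open>2 ^ k\<close> points on the real line, consecutive ones at distance 1, centred at 0.\<close>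

definition pam :: "nat \<Rightarrow> real set" where
  "pam k = (\<lambda>i. real i - (2 ^ k - 1) / 2) ` {..<2 ^ k}"

text \<open>Regular QAM of order \<open>m\<close>: a zero-mean rectangular grid of \<open>2 ^ m\<close> points with spacing 1.
  It is square for \<open>a = b\<close>; odd orders force \<open>a \<noteq> b\<close>.\<close>

definition regular_qam :: "nat \<Rightarrow> complex set \<Rightarrow> bool" where
  "regular_qam m \<Lambda> \<longleftrightarrow>
     (\<exists>a b. a + b = m \<and> \<Lambda> = (\<lambda>(u, v). Complex u v) ` (pam a \<times> pam b))"

lemma finite_pam: "finite (pam k)"
  by (simp add: pam_def)

lemma card_pam: "card (pam k) = 2 ^ k"
  unfolding pam_def by (subst card_image) (auto simp: inj_on_def)

lemma sum_pam: "(\<Sum>u\<in>pam k. u) = 0"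
proof -
  have neg: "- u \<in> pam k" if u: "u \<in> pam k" for u
  proof -
    obtain i where i: "i < 2 ^ k" "u = real i - (2 ^ k - 1) / 2"
      using u by (auto simp: pam_def)
    have "- u = real (2 ^ k - 1 - i) - (2 ^ k - 1) / 2"
      using i by (simp add: of_nat_diff field_simps)
    moreover have "2 ^ k - 1 - i < 2 ^ k" by (simp add: less_imp_diff_less)
    ultimately show ?thesis unfolding pam_def by blast
  qed
  have "(\<Sum>u\<in>pam k. u) = (\<Sum>u\<in>pam k. - u)"
    by (rule sum.reindex_bij_witness[where i = uminus and j = uminus]) (auto intro: neg)
  then show ?thesis by (simp add: sum_negf)
qed

lemma regular_qam_finite: "regular_qam m \<Lambda> \<Longrightarrow> finite \<Lambda>"
  by (auto simp: regular_qam_def finite_pam)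

lemma regular_qam_card: "regular_qam m \<Lambda> \<Longrightarrow> card \<Lambda> = 2 ^ m"
  unfolding regular_qam_def
  by (elim exE conjE, hypsubst, subst card_image)
     (auto simp: inj_on_def card_cartesian_product card_pam power_add)

lemma regular_qam_mean:
  assumes "regular_qam m \<Lambda>"
  shows "(\<Sum>x\<in>\<Lambda>. x) = 0"
proof -
  obtain a b where \<Lambda>: "\<Lambda> = (\<lambda>(u, v). Complex u v) ` (pam a \<times> pam b)"
    using assms by (auto simp: regular_qam_def)
  have "(\<Sum>x\<in>\<Lambda>. x) = (\<Sum>(u, v)\<in>pam a \<times> pam b. Complex u v)"
    unfolding \<Lambda> by (subst sum.reindex) (auto simp: inj_on_def case_prod_unfold)
  also have "\<dots> = (\<Sum>u\<in>pam a. \<Sum>v\<in>pam b. Complex u v)"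
    by (simp add: sum.cartesian_product)
  also have "\<dots> = Complex (\<Sum>u\<in>pam a. \<Sum>v\<in>pam b. u) (\<Sum>u\<in>pam a. \<Sum>v\<in>pam b. v)"
    by (simp add: complex_eq_iff)
  also have "\<dots> = 0"
    by (simp add: sum_pam complex_eq_iff flip: sum_distrib_left)
  finally show ?thesis .
qed


text \<open>The superposition scheme. The packet of the user with the stronger channel carries the finer
  grid; for equal channel magnitudes either assignment is allowed.\<close>

definition discrete_signaling ::
  "complex \<Rightarrow> complex \<Rightarrow> real \<Rightarrow> real \<Rightarrow> nat \<Rightarrow> nat \<Rightarrow> complex set \<Rightarrow> complex set \<Rightarrow> bool" where
  "discrete_signaling h1 h2 P1 P21 m1 m21 X1 X21 \<longleftrightarrow>
     int (m1 + m21) \<le> \<lfloor>log 2 (1 + 6 * (P1 + P21) * max ((cmod h1)\<^sup>2) ((cmod h2)\<^sup>2))\<rfloor> \<and>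
     int m21 \<le> \<lfloor>log 2 (6 * (P1 + P21) * (cmod h2)\<^sup>2)\<rfloor> \<and>
     (let \<eta> = sqrt (6 / (2 ^ (m1 + m21) - 1)) in
      \<exists>\<Lambda>1 \<Lambda>21. regular_qam m1 \<Lambda>1 \<and> regular_qam m21 \<Lambda>21 \<and>
        ((cmod h1 \<ge> cmod h2 \<and>
          X1 = (\<lambda>x. of_real (\<eta> * sqrt (P1 + P21)) * x) ` \<Lambda>1 \<and>
          X21 = (\<lambda>x. of_real (\<eta> * sqrt (2 ^ m1 * (P1 + P21))) * x) ` \<Lambda>21)
       \<or> (cmod h1 \<le> cmod h2 \<and>
          X1 = (\<lambda>x. of_real (\<eta> * sqrt (2 ^ m21 * (P1 + P21))) * x) ` \<Lambda>1 \<and>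
          X21 = (\<lambda>x. of_real (\<eta> * sqrt (P1 + P21)) * x) ` \<Lambda>21)))"


text \<open>\<^bold>\<open>Information density\<close>\<close>

definition chan_density :: "complex \<Rightarrow> complex \<Rightarrow> complex \<Rightarrow> complex \<Rightarrow> real" where
  "chan_density h1 y x1 x2 = 1 / pi * exp (- (cmod (y - h1 * (x1 + x2)))\<^sup>2)"

definition info_density ::
  "complex \<Rightarrow> complex set \<Rightarrow> complex set \<Rightarrow> complex \<Rightarrow> complex \<Rightarrow> real" where
  "info_density h1 X1 X21 x1 y =
     log 2 ((\<Sum>x2\<in>X21. chan_density h1 y x1 x2) /
            (\<Sum>x1'\<in>X1. \<Sum>x2\<in>X21. chan_density h1 y x1' x2 * (1 / real (card X1))))"

text \<open>Joint law of \<open>(X1, X2, Z1)\<close> for one channel use: independent, uniform inputs.\<close>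

definition symbol_law ::
  "complex set \<Rightarrow> complex set \<Rightarrow> (complex \<times> complex \<times> complex) measure" where
  "symbol_law X1 X21 =
     measure_pmf (pmf_of_set X1) \<Otimes>\<^sub>M (measure_pmf (pmf_of_set X21) \<Otimes>\<^sub>M CN01)"

definition mutual_info :: "complex \<Rightarrow> complex set \<Rightarrow> complex set \<Rightarrow> real" where
  "mutual_info h1 X1 X21 =
     (LINT (x1, x2, z)|symbol_law X1 X21. info_density h1 X1 X21 x1 (h1 * (x1 + x2) + z))"

definition dispersion :: "complex \<Rightarrow> complex set \<Rightarrow> complex set \<Rightarrow> real" where
  "dispersion h1 X1 X21 =
     (LINT (x1, x2, z)|symbol_law X1 X21.
        (info_density h1 X1 X21 x1 (h1 * (x1 + x2) + z) - mutual_info h1 X1 X21)\<^sup>2)"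

definition Lratio ::
  "complex \<Rightarrow> complex set \<Rightarrow> complex set \<Rightarrow> complex \<Rightarrow> complex \<Rightarrow> complex \<Rightarrow> real" where
  "Lratio h1 X1 X21 x1 x21 z =
     (\<Sum>x1'\<in>X1. \<Sum>x21'\<in>X21. exp (- (cmod (z + h1 * (x1 - x1' + x21 - x21')))\<^sup>2)) /
     (\<Sum>x21'\<in>X21. exp (- (cmod (z + h1 * (x21 - x21')))\<^sup>2))"


text \<open>\<^bold>\<open>TIN decoding\<close>\<close>

text \<open>A codebook maps a message \<open>w < M\<close> to a codeword of length \<open>N\<close>. Drawing uniformly from
  \<open>codebooks X1 N M\<close> makes all \<open>M * N\<close> coded symbols i.i.d. uniform on \<open>X1\<close>.\<close>

definition codebooks :: "complex set \<Rightarrow> nat \<Rightarrow> nat \<Rightarrow> (nat \<Rightarrow> nat \<Rightarrow> complex) set" where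
  "codebooks X1 N M = ({..<M} \<rightarrow>\<^sub>E ({..<N} \<rightarrow>\<^sub>E X1))"

text \<open>Likelihood of the received word when user 2's symbols are memoryless noise, uniform on
  \<open>X21\<close>; user 2's codebook does not enter.\<close>

definition tin_metric ::
  "complex \<Rightarrow> complex set \<Rightarrow> nat \<Rightarrow> (nat \<Rightarrow> complex) \<Rightarrow> (nat \<Rightarrow> complex) \<Rightarrow> real" where
  "tin_metric h1 X21 N x y =
     (\<Prod>j<N. 1 / real (card X21) * (\<Sum>x2\<in>X21. chan_density h1 (y j) (x j) x2))"

text \<open>Maximum-likelihood decision for that metric; ties go to the smallest message.\<close>

definition tin_decode ::
  "complex \<Rightarrow> complex set \<Rightarrow> nat \<Rightarrow> nat \<Rightarrow> (nat \<Rightarrow> nat \<Rightarrow> complex) \<Rightarrow> (nat \<Rightarrow> complex) \<Rightarrow> nat" where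
  "tin_decode h1 X21 N M c y =
     (LEAST w. w < M \<and> (\<forall>w'<M. tin_metric h1 X21 N (c w') y \<le> tin_metric h1 X21 N (c w) y))"

text \<open>Law of the interference and noise words.\<close>

definition disturbance_law ::
  "complex set \<Rightarrow> nat \<Rightarrow> ((nat \<Rightarrow> complex) \<times> (nat \<Rightarrow> complex)) measure" where
  "disturbance_law X21 N =
     (\<Pi>\<^sub>M j\<in>{..<N}. measure_pmf (pmf_of_set X21)) \<Otimes>\<^sub>M (\<Pi>\<^sub>M j\<in>{..<N}. CN01)"

text \<open>Average error probability over equiprobable messages, for a fixed codebook.\<close>

definition tin_error ::
  "complex \<Rightarrow> complex set \<Rightarrow> nat \<Rightarrow> nat \<Rightarrow> (nat \<Rightarrow> nat \<Rightarrow> complex) \<Rightarrow> real" where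
  "tin_error h1 X21 N M c =
     (1 / real M) * (\<Sum>w<M. \<P>((x2, z) in disturbance_law X21 N.
        tin_decode h1 X21 N M c (\<lambda>j. h1 * (c w j + x2 j) + z j) \<noteq> w))"

text \<open>\<open>M\<close> messages are achievable over \<open>N\<close> symbols with average error probability at most
  \<open>\<epsilon>\<close> under i.i.d. uniform signaling on \<open>X1\<close>. In particular some
  \<open>c \<in> codebooks X1 N M\<close> then has \<open>tin_error h1 X21 N M c \<le> \<epsilon>\<close>.\<close>

definition tin_achievable ::
  "complex \<Rightarrow> complex set \<Rightarrow> complex set \<Rightarrow> nat \<Rightarrow> nat \<Rightarrow> real \<Rightarrow> bool" where
  "tin_achievable h1 X1 X21 N M \<epsilon> \<longleftrightarrow>
     measure_pmf.expectation (pmf_of_set (codebooks X1 N M)) (tin_error h1 X21 N M) \<le> \<epsilon>"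

end

theory Submission
  imports Defs
begin

text \<open>
  Averaging over the random codebook, a message is decoded wrongly only if its own information
  density is at most a threshold \<open>L\<close>, or some other codeword's exceeds \<open>L\<close>. Replacing that other codeword by
  a fresh one and using that \<open>2 powr word_info\<close> averages to 1 over all codewords for every received
  word, the error is at most \<open>P(word_info \<le> L) + M * 2 powr - L\<close>. Take \<open>L = log 2 M + log 2 N / 2\<close>.

  The remaining probability is controlled by a Berry--Esseen bound with the rate \<open>ln n / sqrt n\<close>;
  the logarithmic loss only changes the constant in the \<open>log N / N\<close> term of the rate.
  That bound is obtained by adding to both laws independent Gaussian noise of standard deviation of order
  \<open>sqrt (ln n / n)\<close>: the Gaussian factor of the characteristic functions makes the frequencies above
  \<open>c * sqrt n\<close> negligible, the others are handled by a Taylor expansion, and Levy's inversion formula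
  compares the smoothed laws.
\<close>

section \<open>Smoothing by Gaussian noise\<close>

text \<open>A logarithmic loss is harmless because the normal density near \<open>- Qinv e\<close>
  is bounded below. An error of order ln N / sqrt N in probability is undone by moving the argument
  of the normal distribution function by that order. Rescaled by the standard deviation sqrt (N * V)
  of the word information, this is a constant times ln N, hence of order log N / N in the rate,
  which is also the order of the term log N / 2 in the threshold. Smoothing is used because the
  centred information density enters only through its first three moments, and these say nothing
  about its characteristic function at high frequencies. Gaussian noise supplies the missing decay
  and is paid for by displacing the point of evaluation: a standard deviation of order sqrt (ln n /
  n), cut off at sqrt (ln n) deviations, displaces it by order ln n / sqrt n. Zero dispersion, as
  for a one-point \<open>X1\<close>, leaves nothing to normalise and is a separate case.\<close>

lemma integral_gaussian:
  assumes "a > 0"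
  shows "integrable lborel (\<lambda>t::real. exp (- (a * t\<^sup>2)))"
    and "(LINT t|lborel. exp (- (a * t\<^sup>2))) = sqrt (pi / a)"
proof -
  have eq: "(\<lambda>t. exp (- (a * t\<^sup>2))) = (\<lambda>t. sqrt (pi / a) * normal_density 0 (sqrt (1 / (2 * a))) t)"
    using assms by (auto simp: normal_density_def fun_eq_iff real_sqrt_divide field_simps)
  have s: "sqrt (1 / (2 * a)) > 0" using assms by simp
  show "integrable lborel (\<lambda>t::real. exp (- (a * t\<^sup>2)))"
    unfolding eq using s by (intro integrable_mult_right integrable_normal_density)
  show "(LINT t|lborel. exp (- (a * t\<^sup>2))) = sqrt (pi / a)"
    unfolding eq using s by simp
qed

text \<open>Half of the exponent x^2 / 2 is frozen at its value for |x| = s, the other half stays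
  integrable; integrating exp (- x^2 / 4) against the factor 1 / sqrt (2 pi) produces the sqrt
  2.\<close>

lemma std_normal_tail:
  assumes "s \<ge> 0"
  shows "measure std_normal_distribution {x. \<bar>x\<bar> > s} \<le> sqrt 2 * exp (- (s\<^sup>2 / 4))"
proof -
  have "measure std_normal_distribution {x. \<bar>x\<bar> > s}
      = (LINT x|std_normal_distribution. indicator {x. \<bar>x\<bar> > s} x)"
    by (simp add: Bochner_Integration.integral_indicator)
  also have "\<dots> = (LINT x|lborel. std_normal_density x * indicator {x. \<bar>x\<bar> > s} x)"
    by (subst integral_density) auto
  also have "\<dots> \<le> (LINT x|lborel. exp (- (s\<^sup>2 / 4)) / sqrt (2 * pi) * exp (- (1/4 * x\<^sup>2)))"
  proof (rule integral_mono)
    show "integrable lborel (\<lambda>x. std_normal_density x * indicator {x. \<bar>x\<bar> > s} x)"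
      by (rule integrable_real_mult_indicator) auto
    show "integrable lborel (\<lambda>x. exp (- (s\<^sup>2 / 4)) / sqrt (2 * pi) * exp (- (1/4 * x\<^sup>2)))"
      by (intro integrable_mult_right integral_gaussian) auto
    fix x :: real
    show "std_normal_density x * indicator {x. \<bar>x\<bar> > s} x
        \<le> exp (- (s\<^sup>2 / 4)) / sqrt (2 * pi) * exp (- (1/4 * x\<^sup>2))"
    proof (cases "\<bar>x\<bar> > s")
      case True
      then have "s\<^sup>2 \<le> x\<^sup>2" using assms by (metis abs_le_square_iff abs_of_nonneg less_imp_le)
      then have "exp (- (x\<^sup>2 / 2)) \<le> exp (- (s\<^sup>2 / 4) + - (1/4 * x\<^sup>2))" by simp
      then show ?thesis using True
        by (simp add: std_normal_density_def exp_add[symmetric] divide_right_mono)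
    qed (simp)
  qed
  also have "\<dots> = exp (- (s\<^sup>2 / 4)) / sqrt (2 * pi) * sqrt (pi / (1/4))"
    by (subst integral_mult_right_zero, subst integral_gaussian) auto
  also have "\<dots> = sqrt 2 * exp (- (s\<^sup>2 / 4))"
    by (simp add: real_sqrt_mult field_simps)
  finally show ?thesis .
qed

section \<open>Increments of the normal distribution function\<close>

lemma std_normal_cdf_diff:
  assumes "a \<le> b"
  shows "cdf std_normal_distribution b - cdf std_normal_distribution a
    = (LINT x|lborel. std_normal_density x * indicator {a<..b} x)"
proof -
  interpret N: real_distribution std_normal_distribution by (rule real_dist_normal_dist)
  show ?thesis
  proof (cases "a = b")
    case False
    then have "cdf std_normal_distribution b - cdf std_normal_distribution a
      = measure std_normal_distribution {a<..b}"
      using assms N.cdf_diff_eq by simp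
    also have "\<dots> = (LINT x|std_normal_distribution. indicator {a<..b} x)"
      by (simp add: Bochner_Integration.integral_indicator)
    also have "\<dots> = (LINT x|lborel. std_normal_density x * indicator {a<..b} x)"
      by (subst integral_density) auto
    finally show ?thesis .
  qed simp
qed

text \<open>The density never exceeds 1 / sqrt (2 pi) < 1. This prices the displacement that
  smoothing causes.\<close>

lemma std_normal_cdf_lipschitz:
  assumes "a \<le> b"
  shows "cdf std_normal_distribution b \<le> cdf std_normal_distribution a + (b - a)"
proof -
  have "(LINT x|lborel. std_normal_density x * indicator {a<..b} x)
    \<le> (LINT x|lborel. indicator {a<..b} x)"
  proof (rule integral_mono)
    show "integrable lborel (\<lambda>x. std_normal_density x * indicator {a<..b} x)"
      by (rule integrable_real_mult_indicator) auto
    show "integrable lborel (indicator {a<..b} :: real \<Rightarrow> real)" using assms by auto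
    fix x :: real
    have "sqrt (2 * pi) \<ge> 1" using pi_gt3 by simp
    then have "1 / sqrt (2 * pi) * exp (- x\<^sup>2 / 2) \<le> 1"
      by (intro mult_le_one) auto
    then show "std_normal_density x * indicator {a<..b} x \<le> indicator {a<..b} x"
      by (auto simp: std_normal_density_def split: split_indicator)
  qed
  also have "\<dots> = b - a" using assms by simp
  finally show ?thesis using std_normal_cdf_diff[OF assms] by simp
qed

text \<open>On [-R, R] the density is smallest at the ends. This converse of the Lipschitz bound
  turns an error in probability into a shift of the argument.\<close>

lemma std_normal_cdf_increase:
  assumes "a \<le> b" "\<bar>a\<bar> \<le> R" "\<bar>b\<bar> \<le> R"
  shows "cdf std_normal_distribution a + std_normal_density R * (b - a) \<le> cdf std_normal_distribution b"
proof -
  have "std_normal_density R * (b - a) = (LINT x|lborel. std_normal_density R * indicator {a<..b} x)"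
    using assms by simp
  also have "\<dots> \<le> (LINT x|lborel. std_normal_density x * indicator {a<..b} x)"
  proof (rule integral_mono)
    show "integrable lborel (\<lambda>x. std_normal_density x * indicator {a<..b} x)"
      by (rule integrable_real_mult_indicator) auto
    show "integrable lborel (\<lambda>x. std_normal_density R * indicator {a<..b} x)" using assms by auto
    fix x :: real
    show "std_normal_density R * indicator {a<..b} x \<le> std_normal_density x * indicator {a<..b} x"
    proof (cases "x \<in> {a<..b}")
      case True
      then have "\<bar>x\<bar> \<le> \<bar>R\<bar>" using assms by auto
      then have "x\<^sup>2 \<le> R\<^sup>2" by (simp add: abs_le_square_iff)
      then show ?thesis by (simp add: std_normal_density_def divide_right_mono split: split_indicator)
    qed simp
  qed
  finally show ?thesis using std_normal_cdf_diff[OF assms(1)] by simp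
qed

section \<open>Adding independent Gaussian noise to a real law\<close>

definition gauss_smooth :: "real \<Rightarrow> real measure \<Rightarrow> real measure" where
  "gauss_smooth d M = distr (M \<Otimes>\<^sub>M std_normal_distribution) borel (\<lambda>(x, g). x + d * g)"

context
  fixes M :: "real measure" and d :: real
  assumes M: "real_distribution M"
begin

interpretation M: real_distribution M by (rule M)
interpretation N: real_distribution std_normal_distribution by (rule real_dist_normal_dist)
interpretation P: pair_prob_space M std_normal_distribution ..

lemma gauss_smooth_measurable [measurable]:
  "(\<lambda>(x, g). x + d * g) \<in> borel_measurable (M \<Otimes>\<^sub>M std_normal_distribution)"
  by measurable

lemma real_distribution_gauss_smooth: "real_distribution (gauss_smooth d M)"
  unfolding gauss_smooth_def by (rule P.real_distribution_distr) simp

lemma char_gauss_smooth: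
  "char (gauss_smooth d M) t = char M t * of_real (exp (- ((d * t)\<^sup>2 / 2)))"
proof -
  have "char (gauss_smooth d M) t = (CLINT (x, g)|M \<Otimes>\<^sub>M std_normal_distribution. iexp (t * x) * iexp ((d * t) * g))"
    unfolding char_def gauss_smooth_def
    by (subst integral_distr) (auto simp: case_prod_unfold exp_add[symmetric] algebra_simps)
  also have "\<dots> = (CLINT x|M. CLINT g|std_normal_distribution. iexp (t * x) * iexp ((d * t) * g))"
    by (subst P.integral_fst'[symmetric])
      (auto intro!: P.integrable_const_bound[of _ 1] simp: norm_mult case_prod_unfold)
  also have "\<dots> = char M t * char std_normal_distribution (d * t)"
    by (simp add: char_def)
  finally show ?thesis by (simp add: char_std_normal_distribution)
qed

lemma measure_gauss_smooth:
  assumes [measurable]: "A \<in> sets borel"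
  shows "measure (gauss_smooth d M) A
    = measure (M \<Otimes>\<^sub>M std_normal_distribution) {p. fst p + d * snd p \<in> A}"
  unfolding gauss_smooth_def
  by (subst measure_distr) (auto simp: space_pair_measure vimage_def case_prod_unfold)

lemma gauss_smooth_sets:
  assumes "A \<in> sets borel"
  shows "{p. fst p + d * snd p \<in> A} \<in> sets (M \<Otimes>\<^sub>M std_normal_distribution)"
  using measurable_sets[OF gauss_smooth_measurable assms]
  by (simp add: space_pair_measure vimage_def case_prod_unfold)

lemma pair_fst_sets:
  assumes [measurable]: "A \<in> sets borel"
  shows "{p. fst p \<in> A} \<in> sets (M \<Otimes>\<^sub>M std_normal_distribution)"
proof -
  have eq: "{p. fst p \<in> A} = A \<times> UNIV" by auto
  show ?thesis by (subst eq) simp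
qed

lemma pair_snd_sets:
  assumes [measurable]: "A \<in> sets borel"
  shows "{p. snd p \<in> A} \<in> sets (M \<Otimes>\<^sub>M std_normal_distribution)"
proof -
  have eq: "{p. snd p \<in> A} = UNIV \<times> A" by auto
  show ?thesis by (subst eq) simp
qed

lemmas pair_sets = gauss_smooth_sets pair_fst_sets pair_snd_sets

text \<open>For a fixed first coordinate only the single noise value (a - x) / d hits
  \<open>a\<close>, and it is a null set. Without atoms, Levy's inversion formula applies to every
  interval.\<close>

lemma gauss_smooth_singleton:
  assumes "d \<noteq> 0"
  shows "measure (gauss_smooth d M) {a} = 0"
proof -
  have "emeasure (M \<Otimes>\<^sub>M std_normal_distribution) {p. fst p + d * snd p \<in> {a}}
    = (\<integral>\<^sup>+x. emeasure std_normal_distribution (Pair x -` {p. fst p + d * snd p \<in> {a}}) \<partial>M)"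
    by (intro N.emeasure_pair_measure_alt gauss_smooth_sets) simp
  also have "\<dots> = (\<integral>\<^sup>+x. 0 \<partial>M)"
  proof (intro nn_integral_cong)
    fix x
    have "Pair x -` {p. fst p + d * snd p \<in> {a}} = {(a - x) / d}"
      using assms by (auto simp: field_simps)
    then show "emeasure std_normal_distribution (Pair x -` {p. fst p + d * snd p \<in> {a}}) = 0"
      by (simp add: emeasure_density nn_integral_0_iff_AE AE_lborel_singleton split: split_indicator)
  qed
  finally show ?thesis
    by (subst measure_gauss_smooth) (auto simp: measure_def)
qed

lemma measure_pair_snd:
  assumes [measurable]: "A \<in> sets borel"
  shows "measure (M \<Otimes>\<^sub>M std_normal_distribution) {p. snd p \<in> A} = measure std_normal_distribution A"
proof -
  have eq: "{p. snd p \<in> A} = UNIV \<times> A" by auto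
  have "emeasure (M \<Otimes>\<^sub>M std_normal_distribution) {p. snd p \<in> A} = emeasure M UNIV * emeasure std_normal_distribution A"
    by (subst eq) (simp add: N.emeasure_pair_measure_Times)
  then show ?thesis using M.emeasure_space_1 by (simp add: measure_def)
qed

lemma measure_pair_fst:
  assumes [measurable]: "A \<in> sets borel"
  shows "measure (M \<Otimes>\<^sub>M std_normal_distribution) {p. fst p \<in> A} = measure M A"
proof -
  have eq: "{p. fst p \<in> A} = A \<times> UNIV" by auto
  have "emeasure (M \<Otimes>\<^sub>M std_normal_distribution) {p. fst p \<in> A} = emeasure M A * emeasure std_normal_distribution UNIV"
    by (subst eq) (simp add: N.emeasure_pair_measure_Times)
  then show ?thesis using N.emeasure_space_1 by (simp add: measure_def)
qed

text \<open>Noise of size at most \<open>s\<close> moves a point by at most \<open>d * s\<close>;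
  larger noise is charged to the tail. Keeping the noise as a coordinate of a product measure makes
  this an inclusion of events, here and in the reverse comparison.\<close>

lemma cdf_le_gauss_smooth:
  assumes "d \<ge> 0"
  shows "cdf M x \<le> cdf (gauss_smooth d M) (x + d * s) + measure std_normal_distribution {g. \<bar>g\<bar> > s}"
proof -
  let ?P = "M \<Otimes>\<^sub>M std_normal_distribution"
  have "cdf M x = measure ?P {p. fst p \<in> {..x}}"
    by (subst measure_pair_fst) (auto simp: cdf_def)
  also have "\<dots> \<le> measure ?P ({p. fst p + d * snd p \<in> {..x + d * s}} \<union> {p. snd p \<in> {g. \<bar>g\<bar> > s}})"
  proof (rule P.finite_measure_mono)
    show "{p. fst p \<in> {..x}} \<subseteq> {p. fst p + d * snd p \<in> {..x + d * s}} \<union> {p. snd p \<in> {g. \<bar>g\<bar> > s}}"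
      using assms by (auto intro!: add_mono mult_left_mono)
  qed (intro sets.Un pair_sets; simp)
  also have "\<dots> \<le> measure ?P {p. fst p + d * snd p \<in> {..x + d * s}} + measure ?P {p. snd p \<in> {g. \<bar>g\<bar> > s}}"
    by (intro measure_Un_le pair_sets; simp)
  also have "\<dots> = cdf (gauss_smooth d M) (x + d * s) + measure std_normal_distribution {g. \<bar>g\<bar> > s}"
    by (subst measure_pair_snd, simp) (simp add: cdf_def measure_gauss_smooth)
  finally show ?thesis .
qed

lemma gauss_smooth_le_cdf:
  assumes "d \<ge> 0"
  shows "cdf (gauss_smooth d M) x \<le> cdf M (x + d * s) + measure std_normal_distribution {g. \<bar>g\<bar> > s}"
proof -
  let ?P = "M \<Otimes>\<^sub>M std_normal_distribution"
  have "cdf (gauss_smooth d M) x = measure ?P {p. fst p + d * snd p \<in> {..x}}"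
    by (simp add: cdf_def measure_gauss_smooth)
  also have "\<dots> \<le> measure ?P ({p. fst p \<in> {..x + d * s}} \<union> {p. snd p \<in> {g. \<bar>g\<bar> > s}})"
  proof (rule P.finite_measure_mono)
    show "{p. fst p + d * snd p \<in> {..x}} \<subseteq> {p. fst p \<in> {..x + d * s}} \<union> {p. snd p \<in> {g. \<bar>g\<bar> > s}}"
    proof (intro subsetI, rule ccontr)
      fix p :: "real \<times> real"
      assume p: "p \<in> {p. fst p + d * snd p \<in> {..x}}" "p \<notin> {p. fst p \<in> {..x + d * s}} \<union> {p. snd p \<in> {g. \<bar>g\<bar> > s}}"
      then have "- snd p \<le> s" by auto
      then have "d * (- snd p) \<le> d * s" using assms by (rule mult_left_mono)
      with p show False by auto
    qed
  qed (intro sets.Un pair_sets; simp)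
  also have "\<dots> \<le> measure ?P {p. fst p \<in> {..x + d * s}} + measure ?P {p. snd p \<in> {g. \<bar>g\<bar> > s}}"
    by (intro measure_Un_le pair_sets; simp)
  also have "\<dots> = cdf M (x + d * s) + measure std_normal_distribution {g. \<bar>g\<bar> > s}"
    unfolding cdf_def by (subst measure_pair_snd, simp, subst measure_pair_fst) simp_all
  finally show ?thesis .
qed

end

text \<open>In Levy's inversion formula for the interval from \<open>a\<close> to \<open>b\<close>
  the kernel is at most 2 / |t| in modulus, whatever \<open>a\<close> is. The factor |t| in
  \<open>bnd\<close> cancels this singularity, so \<open>G\<close> dominates the integrand uniformly
  and \<open>a\<close> can be sent to minus infinity.\<close>

lemma cdf_diff_le_char_diff:
  assumes M: "real_distribution M" and N: "real_distribution N"
    and atomM: "\<And>a. measure M {a} = 0" and atomN: "\<And>a. measure N {a} = 0"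
    and G: "integrable lborel G" "\<And>t. 0 \<le> G t"
    and bnd: "\<And>t. 2 * cmod (char M t - char N t) \<le> \<bar>t\<bar> * G t"
  shows "cdf M b - cdf N b \<le> (LINT t|lborel. G t)"
proof -
  interpret M: real_distribution M by (rule M)
  interpret N: real_distribution N by (rule N)
  have int: "cdf M b - cdf M a \<le> cdf N b - cdf N a + (LINT t|lborel. G t)" if "a < b" for a
  proof -
    define F where "F t = (iexp (-(t * a)) - iexp (-(t * b))) / (\<i> * t)" for t :: real
    have [measurable]: "F \<in> borel_measurable borel" unfolding F_def by measurable
    \<comment> \<open>This bound degrades as \<open>a\<close> decreases; it serves only the
      integrability on bounded ranges of \<open>t\<close>, while the final estimate relies on 2 /
      |t|.\<close>
    have Fbd: "cmod (F t) \<le> b - a" if "t \<noteq> 0" for t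
      using Levy_Inversion_aux2[of "-b" "-a" t] that \<open>a < b\<close> by (simp add: F_def)
    have F0: "F 0 = 0" by (simp add: F_def)
    have Fb: "cmod (F t) \<le> b - a" for t
      using Fbd[of t] F0 \<open>a < b\<close> by (cases "t = 0") auto
    let ?I = "\<lambda>M T. 1 / (2 * pi) * (CLBINT t=-T..T. F t * char M t)"
    have L1: "(\<lambda>T::nat. ?I M T) \<longlonglongrightarrow> complex_of_real (measure M {a<..b})"
      using M.Levy_Inversion[of a b] that atomM by (simp add: F_def)
    have L2: "(\<lambda>T::nat. ?I N T) \<longlonglongrightarrow> complex_of_real (measure N {a<..b})"
      using N.Levy_Inversion[of a b] that atomN by (simp add: F_def)
    have si: "set_integrable lborel {-real T<..<real T} (\<lambda>t. F t * char L t)"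
      if L: "real_distribution L" for L and T :: nat
    proof -
      interpret L: real_distribution L by (rule L)
      show ?thesis unfolding set_integrable_def
      proof (rule integrableI_bounded_set_indicator[where B="b - a"])
        show "AE x in lborel. x \<in> {-real T<..<real T} \<longrightarrow> cmod (F x * char L x) \<le> b - a"
        proof (intro AE_I2 impI)
          fix x
          have "cmod (F x) * cmod (char L x) \<le> (b - a) * 1"
            using \<open>a < b\<close> by (intro mult_mono Fb L.cmod_char_le_1) auto
          then show "cmod (F x * char L x) \<le> b - a" by (simp only: norm_mult) simp
        qed
      qed (use \<open>a < b\<close> in auto)
    qed
    have bd: "cmod (?I M T - ?I N T) \<le> (LINT t|lborel. G t)" for T :: nat
    proof -
      have TT: "ereal (- real T) \<le> ereal (real T)" by simp
      let ?D = "\<lambda>t. F t * char M t - F t * char N t"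
      have D: "(CLBINT t=-real T..real T. F t * char M t) - (CLBINT t=-real T..real T. F t * char N t)
        = (CLBINT t:{-real T<..<real T}. ?D t)"
        unfolding set_integral_diff(2)[OF si[OF M, of T] si[OF N, of T]]
        by (simp only: interval_lebesgue_integral_def TT if_True uminus_ereal.simps einterval_eq)
      have "cmod (CLBINT t:{-real T<..<real T}. ?D t)
        \<le> (LINT t|lborel. cmod (indicator {-real T<..<real T} t *\<^sub>R ?D t))"
        unfolding set_lebesgue_integral_def by (rule integral_norm_bound)
      also have "\<dots> \<le> (LINT t|lborel. G t)"
      proof (rule integral_mono)
        show "integrable lborel (\<lambda>t. cmod (indicator {-real T<..<real T} t *\<^sub>R (F t * char M t - F t * char N t)))"
          using set_integral_diff(1)[OF si[OF M, of T] si[OF N, of T]]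
          unfolding set_integrable_def by (rule integrable_norm)
        fix t
        show "cmod (indicator {-real T<..<real T} t *\<^sub>R (F t * char M t - F t * char N t)) \<le> G t"
        proof (cases "t = 0")
          case False
          have "cmod (iexp (-(t * a)) - iexp (-(t * b))) \<le> 2"
            using norm_triangle_ineq4[of "iexp (-(t * a))" "iexp (-(t * b))"] by simp
          then have "cmod (F t) \<le> 2 / \<bar>t\<bar>"
            by (simp add: F_def norm_divide norm_mult divide_right_mono)
          then have "cmod (F t) * cmod (char M t - char N t) \<le> 2 / \<bar>t\<bar> * cmod (char M t - char N t)"
            by (rule mult_right_mono) simp
          also have "\<dots> \<le> G t" using bnd[of t] False by (simp add: field_simps)
          finally have "cmod (F t * char M t - F t * char N t) \<le> G t"
            by (simp only: right_diff_distrib[symmetric] norm_mult)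
          then show ?thesis using G(2)[of t] by (simp split: split_indicator)
        qed (use G(2)[of 0] F0 in simp)
      qed (rule G)
      finally have "cmod (CLBINT t:{-real T<..<real T}. ?D t) \<le> (LINT t|lborel. G t)" .
      then have *: "cmod ((CLBINT t=-real T..real T. F t * char M t) - (CLBINT t=-real T..real T. F t * char N t))
        \<le> (LINT t|lborel. G t)" by (simp only: D)
      have "cmod (?I M T - ?I N T) = 1 / (2 * pi) *
        cmod ((CLBINT t=-real T..real T. F t * char M t) - (CLBINT t=-real T..real T. F t * char N t))"
        unfolding right_diff_distrib[symmetric] norm_mult by (simp add: norm_divide norm_mult)
      also have "\<dots> \<le> 1 * (LINT t|lborel. G t)"
        using pi_gt3 by (intro mult_mono *) (auto)
      finally show ?thesis by simp
    qed
    have "(\<lambda>T::nat. cmod (?I M T - ?I N T)) \<longlonglongrightarrow>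
      cmod (complex_of_real (measure M {a<..b}) - complex_of_real (measure N {a<..b}))"
      by (intro tendsto_norm tendsto_diff L1 L2)
    then have "cmod (complex_of_real (measure M {a<..b}) - complex_of_real (measure N {a<..b})) \<le> (LINT t|lborel. G t)"
      by (rule LIMSEQ_le_const2) (use bd in blast)
    then have "measure M {a<..b} - measure N {a<..b} \<le> (LINT t|lborel. G t)"
      by (metis abs_le_D1 norm_of_real of_real_diff)
    then show ?thesis using M.cdf_diff_eq[OF that] N.cdf_diff_eq[OF that] by simp
  qed
  \<comment> \<open>The integral of \<open>G\<close> does not depend on \<open>a\<close>, so the
    choice a = -n and a limit turn interval masses into distribution functions.\<close>
  have "(\<lambda>n. cdf M b - cdf M (- real n)) \<longlonglongrightarrow> cdf M b - 0"
    by (intro tendsto_diff tendsto_const M.cdf_lim_neg_infty)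
  moreover have "(\<lambda>n. cdf N b - cdf N (- real n) + (LINT t|lborel. G t)) \<longlonglongrightarrow> cdf N b - 0 + (LINT t|lborel. G t)"
    by (intro tendsto_add tendsto_diff tendsto_const N.cdf_lim_neg_infty)
  moreover have "eventually (\<lambda>n. cdf M b - cdf M (- real n) \<le> cdf N b - cdf N (- real n) + (LINT t|lborel. G t)) sequentially"
  proof -
    obtain n0 where "- b < real n0" using reals_Archimedean2 by blast
    then show ?thesis by (intro eventually_sequentiallyI[of n0] int) (smt (verit) of_nat_mono)
  qed
  ultimately have "cdf M b - 0 \<le> cdf N b - 0 + (LINT t|lborel. G t)"
    by (intro tendsto_le[OF sequentially_bot])
  then show ?thesis by simp
qed

section \<open>A Berry--Esseen bound with logarithmic loss\<close>

text \<open>Lets every term of order 1 / sqrt n be absorbed into ln n / sqrt n with a factor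
  2.\<close>

lemma ln_ge_half:
  fixes n :: nat
  assumes "n \<ge> 2"
  shows "ln n \<ge> 1 / 2"
proof -
  have "exp (1/2::real) \<le> 2"
    using exp_bound_half[of "1/2::real"] by simp
  also have "2 \<le> real n" using assms by simp
  finally show ?thesis using assms ln_ge_iff[of "real n" "1/2"] by simp
qed

text \<open>The upper side inverts exp x \<ge> 1 + x + x^2 / 2, using (1 - x + x^2 / 2) * (1 + x +
  x^2 / 2) = 1 + x^4 / 4 \<ge> 1.\<close>

lemma abs_exp_minus_le:
  fixes x :: real
  assumes "x \<ge> 0"
  shows "\<bar>exp (- x) - (1 - x)\<bar> \<le> x\<^sup>2 / 2"
proof -
  have "exp (- x) \<ge> 1 - x" using exp_ge_add_one_self[of "- x"] by simp
  moreover have "exp (- x) \<le> 1 - x + x\<^sup>2 / 2"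
  proof -
    have "1 + x + x\<^sup>2 / 2 \<le> exp x" using exp_lower_Taylor_quadratic[OF assms] .
    moreover have "1 + x + x\<^sup>2 / 2 > 0" using assms by (simp add: add_pos_nonneg)
    ultimately have "exp (- x) \<le> 1 / (1 + x + x\<^sup>2 / 2)"
      by (simp add: exp_minus field_simps)
    also have "\<dots> \<le> 1 - x + x\<^sup>2 / 2"
    proof -
      have "(1 - x + x\<^sup>2 / 2) * (1 + x + x\<^sup>2 / 2) = 1 + x ^ 4 / 4"
        by (simp add: algebra_simps power2_eq_square power4_eq_xxxx)
      then have "1 \<le> (1 - x + x\<^sup>2 / 2) * (1 + x + x\<^sup>2 / 2)" by simp
      then show ?thesis using \<open>1 + x + x\<^sup>2 / 2 > 0\<close> by (simp add: pos_divide_le_eq)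
    qed
    finally show ?thesis .
  qed
  ultimately show ?thesis by simp
qed

text \<open>Factor z^n - w^n as (z - w) times a sum of n products of n - 1 factors. Keeping m^(n-1)
  instead of bounding it by 1 is essential later: with a Gaussian \<open>m\<close> it preserves a
  Gaussian decay.\<close>

lemma norm_power_diff_le:
  fixes z w :: complex
  assumes "cmod z \<le> m" "cmod w \<le> m"
  shows "cmod (z ^ n - w ^ n) \<le> real n * m ^ (n - 1) * cmod (z - w)"
proof -
  have m: "m \<ge> 0" using assms(1) norm_ge_zero order_trans by blast
  have "cmod (\<Sum>i<n. w ^ (n - Suc i) * z ^ i) \<le> (\<Sum>i<n. m ^ (n - 1))"
  proof (intro sum_norm_le)
    fix i assume "i \<in> {..<n}"
    then have "n - 1 = (n - Suc i) + i" by simp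
    then have "m ^ (n - 1) = m ^ (n - Suc i) * m ^ i" by (metis power_add)
    then show "cmod (w ^ (n - Suc i) * z ^ i) \<le> m ^ (n - 1)"
      using assms m by (simp add: norm_mult norm_power mult_mono power_mono)
  qed
  then have "cmod (z - w) * cmod (\<Sum>i<n. w ^ (n - Suc i) * z ^ i) \<le> cmod (z - w) * (real n * m ^ (n - 1))"
    by (intro mult_left_mono) auto
  then show ?thesis by (simp add: power_diff_sumr2 norm_mult mult_ac)
qed

section \<open>Powers of the characteristic function of a normalised law\<close>

context
  fixes M :: "real measure"
  assumes M: "real_distribution M"
    and int3: "integrable M (\<lambda>x. \<bar>x\<bar> ^ 3)"
    and mean: "(LINT x|M. x) = 0"
    and var: "(LINT x|M. x\<^sup>2) = 1"
begin

interpretation M: real_distribution M by (rule M)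

text \<open>Both functions are compared with 1 - s^2 / 2: \<open>\<rho> / 6\<close> comes from the
  third-order Taylor remainder, 1 / 8 from (s^2 / 2)^2 / 2 and |s| \<le> 1. The window for
  \<open>s\<close> yields |s| \<le> 1 and |s| * \<open>\<rho>\<close> \<le> 1 together; the latter
  bounds the cubic remainder by s^2 / 4, so that 1 - s^2 / 4 survives as a bound on the
  modulus.\<close>

lemma char_near_gaussian:
  fixes s :: real
  defines "\<rho> \<equiv> (LINT x|M. \<bar>x\<bar> ^ 3)"
  assumes "\<bar>s\<bar> \<le> 1 / (1 + \<rho>)"
  shows "cmod (char M s) \<le> exp (- (s\<^sup>2 / 4))"
    and "cmod (char M s - of_real (exp (- (s\<^sup>2 / 2)))) \<le> (\<rho> / 6 + 1 / 8) * \<bar>s\<bar> ^ 3"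
proof -
  have \<rho>: "\<rho> \<ge> 0" unfolding \<rho>_def by simp
  have bound: "\<bar>x\<bar> ^ k \<le> 1 + \<bar>x\<bar> ^ 3" if "k \<le> 3" for k and x :: real
  proof (cases "\<bar>x\<bar> \<le> 1")
    case True
    then show ?thesis using power_le_one[of "\<bar>x\<bar>" k] by (smt (verit) abs_ge_zero zero_le_power)
  next
    case False
    then have "\<bar>x\<bar> ^ k \<le> \<bar>x\<bar> ^ 3" using that by (intro power_increasing) auto
    then show ?thesis by simp
  qed
  have i1: "integrable M (\<lambda>x. x)"
    by (rule Bochner_Integration.integrable_bound[of M "\<lambda>x. 1 + \<bar>x\<bar> ^ 3"])
      (use int3 bound[of 1] in auto)
  have i2: "integrable M (\<lambda>x. x\<^sup>2)"
    by (rule Bochner_Integration.integrable_bound[of M "\<lambda>x. 1 + \<bar>x\<bar> ^ 3"])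
      (use int3 bound[of 2] in auto)
  have "cmod (char M s - (1 - s\<^sup>2 * 1 / 2)) \<le> (s\<^sup>2 / 6) * (LINT x|M. min (6 * x\<^sup>2) (\<bar>s\<bar> * \<bar>x\<bar> ^ 3))"
    using M.char_approx3[of 1 s] i1 i2 mean var by simp
  also have "\<dots> \<le> (s\<^sup>2 / 6) * (LINT x|M. \<bar>s\<bar> * \<bar>x\<bar> ^ 3)"
  proof (intro mult_left_mono integral_mono)
    show "integrable M (\<lambda>x. min (6 * x\<^sup>2) (\<bar>s\<bar> * \<bar>x\<bar> ^ 3))"
      by (rule Bochner_Integration.integrable_bound[of M "\<lambda>x. \<bar>s\<bar> * \<bar>x\<bar> ^ 3"]) (use int3 in auto)
  qed (use int3 in auto)
  also have "\<dots> = \<rho> / 6 * \<bar>s\<bar> ^ 3"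
    by (simp add: \<rho>_def power2_eq_square power3_eq_cube abs_if)
  finally have A: "cmod (char M s - (1 - s\<^sup>2 / 2)) \<le> \<rho> / 6 * \<bar>s\<bar> ^ 3" by simp
  have s\<rho>: "\<bar>s\<bar> * (1 + \<rho>) \<le> 1" using assms(2) \<rho> by (simp add: field_simps)
  have s1: "\<bar>s\<bar> \<le> 1" "\<bar>s\<bar> * \<rho> \<le> 1"
    using s\<rho> \<rho> by (auto simp: algebra_simps) (smt (verit) mult_nonneg_nonneg)+
  have sq: "s\<^sup>2 \<le> 1" using s1 by (simp add: abs_square_le_1)
  have "\<bar>s\<bar> ^ 3 * \<rho> = s\<^sup>2 * (\<bar>s\<bar> * \<rho>)" by (simp add: power2_eq_square power3_eq_cube abs_if)
  also have "\<dots> \<le> s\<^sup>2 * 1" using s1 by (intro mult_left_mono) auto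
  finally have "\<rho> * \<bar>s\<bar> ^ 3 \<le> s\<^sup>2" by (simp add: mult.commute)
  then have c: "\<rho> / 6 * \<bar>s\<bar> ^ 3 \<le> s\<^sup>2 / 4" using zero_le_power2[of s] by linarith
  have "cmod (char M s) \<le> cmod (1 - s\<^sup>2 / 2) + cmod (char M s - (1 - s\<^sup>2 / 2))"
    by (metis add.commute norm_triangle_sub)
  also have "cmod (1 - s\<^sup>2 / 2) = 1 - s\<^sup>2 / 2"
  proof -
    have "(1 - s\<^sup>2 / 2 :: complex) = of_real (1 - s\<^sup>2 / 2)" by simp
    then show ?thesis using sq by (simp only: norm_of_real)
  qed
  finally have "cmod (char M s) \<le> 1 - s\<^sup>2 / 4" using A c by simp
  also have "\<dots> \<le> exp (- (s\<^sup>2 / 4))" using exp_ge_add_one_self[of "- (s\<^sup>2 / 4)"] by simp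
  finally show "cmod (char M s) \<le> exp (- (s\<^sup>2 / 4))" .
  have "\<bar>exp (- (s\<^sup>2 / 2)) - (1 - s\<^sup>2 / 2)\<bar> \<le> (s\<^sup>2 / 2)\<^sup>2 / 2"
    by (rule abs_exp_minus_le) simp
  also have "\<dots> = 1 / 8 * (\<bar>s\<bar> ^ 3 * \<bar>s\<bar>)"
    by (simp add: power2_eq_square power3_eq_cube abs_if)
  also have "\<dots> \<le> 1 / 8 * (\<bar>s\<bar> ^ 3 * 1)"
    using s1 by (intro mult_left_mono) auto
  finally have B': "\<bar>exp (- (s\<^sup>2 / 2)) - (1 - s\<^sup>2 / 2)\<bar> \<le> 1 / 8 * \<bar>s\<bar> ^ 3" by simp
  have B: "cmod (of_real (exp (- (s\<^sup>2 / 2))) - (1 - s\<^sup>2 / 2)) \<le> 1 / 8 * \<bar>s\<bar> ^ 3"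
  proof -
    have "(of_real (exp (- (s\<^sup>2 / 2))) - (1 - s\<^sup>2 / 2) :: complex) = of_real (exp (- (s\<^sup>2 / 2)) - (1 - s\<^sup>2 / 2))"
      by simp
    then show ?thesis
      using B' by (simp only: norm_of_real)
  qed
  have "cmod (char M s - of_real (exp (- (s\<^sup>2 / 2))))
    \<le> cmod (char M s - (1 - s\<^sup>2 / 2)) + cmod (of_real (exp (- (s\<^sup>2 / 2))) - (1 - s\<^sup>2 / 2))"
    using norm_triangle_ineq4[of "char M s - (1 - s\<^sup>2 / 2)" "of_real (exp (- (s\<^sup>2 / 2))) - (1 - s\<^sup>2 / 2)"] by simp
  with A B show "cmod (char M s - of_real (exp (- (s\<^sup>2 / 2)))) \<le> (\<rho> / 6 + 1 / 8) * \<bar>s\<bar> ^ 3"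
    by (simp add: algebra_simps)
qed

lemma char_power_near_gaussian:
  fixes t :: real
  defines "\<rho> \<equiv> (LINT x|M. \<bar>x\<bar> ^ 3)"
  assumes n: "n \<ge> 2" and t: "\<bar>t\<bar> \<le> 1 / (1 + \<rho>) * sqrt n"
  shows "cmod (char M (t / sqrt n) ^ n - of_real (exp (- (t\<^sup>2 / 2))))
    \<le> (\<rho> / 6 + 1 / 8) * \<bar>t\<bar> ^ 3 / sqrt n * exp (- (t\<^sup>2 / 8))"
proof -
  define s where "s = t / sqrt n"
  have n0: "sqrt n > 0" using n by simp
  have s: "\<bar>s\<bar> \<le> 1 / (1 + \<rho>)"
    using t n0 by (simp add: s_def pos_divide_le_eq)
  have ns: "real n * s\<^sup>2 = t\<^sup>2" using n by (simp add: s_def power_divide)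
  have e: "exp (- (s\<^sup>2 / 2)) ^ n = exp (- (t\<^sup>2 / 2))"
    unfolding exp_of_nat_mult[symmetric] ns[symmetric] by simp
  have "cmod (char M s ^ n - of_real (exp (- (s\<^sup>2 / 2))) ^ n)
    \<le> real n * exp (- (s\<^sup>2 / 4)) ^ (n - 1) * cmod (char M s - of_real (exp (- (s\<^sup>2 / 2))))"
  proof (rule norm_power_diff_le)
    show "cmod (char M s) \<le> exp (- (s\<^sup>2 / 4))"
      using char_near_gaussian(1) s unfolding \<rho>_def by blast
  qed simp
  also have "\<dots> \<le> real n * exp (- (t\<^sup>2 / 8)) * ((\<rho> / 6 + 1 / 8) * \<bar>s\<bar> ^ 3)"
  proof (intro mult_mono)
    show "cmod (char M s - of_real (exp (- (s\<^sup>2 / 2)))) \<le> (\<rho> / 6 + 1 / 8) * \<bar>s\<bar> ^ 3"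
      using char_near_gaussian(2) s unfolding \<rho>_def by blast
    \<comment> \<open>One of the n factors is lost in the telescoping; n - 1 \<ge> n / 2 still
      leaves half of the decay exp (- t^2 / 4), whence the 8.\<close>
    have "real n \<le> 2 * real (n - 1)" using n by linarith
    then have "real n * s\<^sup>2 \<le> 2 * real (n - 1) * s\<^sup>2" by (rule mult_right_mono) simp
    then have "t\<^sup>2 / 8 \<le> real (n - 1) * (s\<^sup>2 / 4)" using ns by simp
    then show "exp (- (s\<^sup>2 / 4)) ^ (n - 1) \<le> exp (- (t\<^sup>2 / 8))"
      unfolding exp_of_nat_mult[symmetric] by simp
  qed auto
  also have "\<dots> = (\<rho> / 6 + 1 / 8) * \<bar>t\<bar> ^ 3 / sqrt n * exp (- (t\<^sup>2 / 8))"
  proof -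
    have "real n * \<bar>s\<bar> ^ 3 = real n * \<bar>t\<bar> ^ 3 / (sqrt n) ^ 3"
      by (simp add: s_def power_divide)
    also have "(sqrt n) ^ 3 = real n * sqrt n" by (simp add: power3_eq_cube)
    finally have "real n * \<bar>s\<bar> ^ 3 = \<bar>t\<bar> ^ 3 / sqrt n" using n by simp
    then have "real n * \<bar>s\<bar> ^ 3 * (exp (- (t\<^sup>2 / 8)) * (\<rho> / 6 + 1 / 8))
      = \<bar>t\<bar> ^ 3 / sqrt n * (exp (- (t\<^sup>2 / 8)) * (\<rho> / 6 + 1 / 8))" by (simp only:)
    then show ?thesis by (simp add: mult_ac)
  qed
  finally show ?thesis using e by (simp add: s_def of_real_power[symmetric] del: of_real_power)
qed

text \<open>The three parts of \<open>C\<close> are the integral of \<open>G\<close>, two noise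
  tails and two displacements \<open>d * s\<close>. The first two are of order 1 / sqrt n and carry
  the factor 2 of their conversion to ln n / sqrt n; the Lipschitz constant of the normal
  distribution function is taken as 1.\<close>

lemma berry_esseen_log_aux:
  defines "\<rho> \<equiv> (LINT x|M. \<bar>x\<bar> ^ 3)"
  defines "K \<equiv> \<rho> / 6 + 1 / 8" and "c \<equiv> 1 / (1 + \<rho>)"
  defines "C \<equiv> 2 * (128 * K * sqrt pi + 8 * sqrt pi) + 4 * sqrt 2 + 4 * sqrt 2 / c"
  assumes n: "n \<ge> 2" and N: "real_distribution N"
    and char: "\<And>t. char N t = char M (t / sqrt n) ^ n"
  shows "cdf N x \<le> cdf std_normal_distribution x + C * (ln n / sqrt n)"
proof -
  have \<rho>: "\<rho> \<ge> 0" unfolding \<rho>_def by simp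
  then have K: "K > 0" and c: "c > 0" by (auto simp: K_def c_def add_nonneg_pos)
  have rn: "real n \<ge> 2" using n by simp
  have n0: "sqrt n > 0" using n by simp
  have lnn: "ln n \<ge> 1 / 2" using ln_ge_half[OF n] .
  \<comment> \<open>chosen so that \<open>exp (- (d * t)\<^sup>2 / 4) \<le> 1 / n\<close> once \<open>\<bar>t\<bar> \<ge> c * sqrt n\<close>\<close>
  define d where "d = 2 * sqrt (ln n) / (c * sqrt n)"
  have d: "d > 0" using lnn c n0 n by (auto simp: d_def intro!: divide_pos_pos mult_pos_pos)
  have d2: "d\<^sup>2 = 4 * ln n / (c\<^sup>2 * real n)"
    using lnn by (simp add: d_def power_divide power_mult_distrib)
  let ?\<Phi> = std_normal_distribution
  \<comment> \<open>The first summand dominates the frequencies up to \<open>c * sqrt n\<close>,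
    where the Taylor estimate holds. The second dominates those above: there the unsmoothed
    difference is at most 2, half of the Gaussian exponent gives 1 / n, the other half keeps the
    bound integrable, and 1 \<le> |t| / (c * sqrt n) supplies the factor |t|.\<close>
  define G where "G t = 32 * K / sqrt n * exp (- (1 / 16 * t\<^sup>2))
    + 4 / (c * sqrt n * n) * exp (- (d\<^sup>2 / 4 * t\<^sup>2))" for t :: real
  have Gint: "integrable lborel G" unfolding G_def
    by (intro Bochner_Integration.integrable_add integrable_mult_right integral_gaussian) (use d in auto)
  have IG: "(LINT t|lborel. G t) \<le> (128 * K * sqrt pi + 8 * sqrt pi) / sqrt n"
  proof -
    have "(LINT t|lborel. G t) = 32 * K / sqrt n * sqrt (pi / (1 / 16)) + 4 / (c * sqrt n * n) * sqrt (pi / (d\<^sup>2 / 4))"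
      unfolding G_def
      by (subst Bochner_Integration.integral_add;
          (intro integrable_mult_right integral_gaussian)?; (simp only: integral_mult_right_zero)?;
          (subst integral_gaussian)?; (subst integral_gaussian)?; use d in simp)
    also have "sqrt (pi / (1 / 16)) = 4 * sqrt pi" by (simp add: real_sqrt_mult)
    also have "sqrt (pi / (d\<^sup>2 / 4)) = 2 * sqrt pi / d"
      using d by (simp add: real_sqrt_divide real_sqrt_mult)
    also have "2 * sqrt pi / d = sqrt pi * c * sqrt n / sqrt (ln n)"
      by (simp add: d_def)
    also have "4 / (c * sqrt n * n) * (sqrt pi * c * sqrt n / sqrt (ln n)) = 4 * sqrt pi / n / sqrt (ln n)"
      using c n0 by simp
    also have "\<dots> \<le> 4 * sqrt pi / n / (1 / 2)"
    proof (intro divide_left_mono)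
      have "sqrt (1/4) \<le> sqrt (ln n)" using lnn by (intro real_sqrt_le_mono) simp
      then show "1 / 2 \<le> sqrt (ln n)" by (simp add: real_sqrt_divide)
      then have "0 < sqrt (ln n)" by linarith
      then show "0 < sqrt (ln n) * (1 / 2)" by simp
    qed auto
    also have "\<dots> = 8 * sqrt pi / n" by simp
    also have "\<dots> \<le> 8 * sqrt pi / sqrt n"
    proof (intro divide_left_mono)
      show "sqrt n \<le> n" using rn by (intro real_le_lsqrt) (auto simp: power2_eq_square)
    qed (use n0 n in auto)
    finally show ?thesis by (simp add: add_divide_distrib)
  qed
  have G0: "G t \<ge> 0" for t unfolding G_def using K c by (intro add_nonneg_nonneg) auto
  have bnd: "2 * cmod (char (gauss_smooth d N) t - char (gauss_smooth d ?\<Phi>) t) \<le> \<bar>t\<bar> * G t" for t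
  proof -
    let ?D = "cmod (char N t - of_real (exp (- (t\<^sup>2 / 2))))"
    have "char (gauss_smooth d N) t - char (gauss_smooth d ?\<Phi>) t
      = (char N t - of_real (exp (- (t\<^sup>2 / 2)))) * of_real (exp (- ((d * t)\<^sup>2 / 2)))"
      by (simp add: char_gauss_smooth N real_dist_normal_dist char_std_normal_distribution algebra_simps)
    then have D: "cmod (char (gauss_smooth d N) t - char (gauss_smooth d ?\<Phi>) t) = ?D * exp (- ((d * t)\<^sup>2 / 2))"
      by (simp only: norm_mult norm_of_real abs_exp_cancel)
    show ?thesis
    proof (cases "\<bar>t\<bar> \<le> c * sqrt n")
      case True
      have "?D \<le> K * \<bar>t\<bar> ^ 3 / sqrt n * exp (- (t\<^sup>2 / 8))"
        using char_power_near_gaussian[OF n] True unfolding K_def c_def \<rho>_def char by simp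
      then have "?D * exp (- ((d * t)\<^sup>2 / 2)) \<le> K * \<bar>t\<bar> ^ 3 / sqrt n * exp (- (t\<^sup>2 / 8)) * 1"
        by (rule mult_mono) (use K in auto)
      also have "\<dots> = \<bar>t\<bar> * (K / sqrt n) * (t\<^sup>2 * exp (- (t\<^sup>2 / 8)))"
        by (simp add: power2_eq_square power3_eq_cube abs_if)
      also have "\<dots> \<le> \<bar>t\<bar> * (K / sqrt n) * (16 * exp (- (1 / 16 * t\<^sup>2)))"
      proof (intro mult_left_mono)
        \<comment> \<open>Half of the exponent t^2 / 8 is spent on absorbing the polynomial factor
          t^2.\<close>
        have "t\<^sup>2 / 16 \<le> exp (t\<^sup>2 / 16)" using exp_ge_add_one_self[of "t\<^sup>2/16"] by linarith
        then have "t\<^sup>2 \<le> 16 * exp (t\<^sup>2 / 16)" by simp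
        then have "t\<^sup>2 * exp (- (t\<^sup>2 / 8)) \<le> 16 * exp (t\<^sup>2 / 16) * exp (- (t\<^sup>2 / 8))"
          by (rule mult_right_mono) simp
        then show "t\<^sup>2 * exp (- (t\<^sup>2 / 8)) \<le> 16 * exp (- (1 / 16 * t\<^sup>2))"
          by (simp only: mult.assoc exp_add[symmetric]) simp
      qed (use K in auto)
      finally have "2 * (?D * exp (- ((d * t)\<^sup>2 / 2))) \<le> 2 * (\<bar>t\<bar> * (K / sqrt n) * (16 * exp (- (1 / 16 * t\<^sup>2))))"
        by (rule mult_left_mono) simp
      also have "\<dots> = \<bar>t\<bar> * (32 * K / sqrt n * exp (- (1 / 16 * t\<^sup>2)))" by simp
      also have "\<dots> \<le> \<bar>t\<bar> * G t"
        unfolding G_def using c by (intro mult_left_mono) auto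
      finally show ?thesis using D by simp
    next
      case False
      have "?D \<le> cmod (char N t) + cmod (of_real (exp (- (t\<^sup>2 / 2))) :: complex)"
        by (rule norm_triangle_ineq4)
      also have "\<dots> \<le> 1 + 1"
        by (intro add_mono real_distribution.cmod_char_le_1 N) (simp only: norm_of_real abs_exp_cancel, simp)
      finally have D2: "?D \<le> 2" by simp
      have ct: "(c * sqrt n)\<^sup>2 \<le> t\<^sup>2"
        using False c power_mono[of "c * sqrt n" "\<bar>t\<bar>" 2] by (simp del: power_mult_distrib)
      have "exp (- ((d * t)\<^sup>2 / 2)) = exp (- (d\<^sup>2 * t\<^sup>2 / 4)) * exp (- (d\<^sup>2 / 4 * t\<^sup>2))"
        by (simp add: exp_add[symmetric] power_mult_distrib)
      also have "\<dots> \<le> 1 / n * exp (- (d\<^sup>2 / 4 * t\<^sup>2))"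
      proof (intro mult_right_mono)
        have "ln n = d\<^sup>2 * (c * sqrt n)\<^sup>2 / 4"
          using c n0 n by (simp add: d2 power_mult_distrib)
        also have "\<dots> \<le> d\<^sup>2 * t\<^sup>2 / 4" using ct by (intro divide_right_mono mult_left_mono) auto
        finally have "exp (- (d\<^sup>2 * t\<^sup>2 / 4)) \<le> exp (- ln n)" by simp
        then show "exp (- (d\<^sup>2 * t\<^sup>2 / 4)) \<le> 1 / n" using n by (simp add: exp_minus inverse_eq_divide)
      qed simp
      finally have "?D * exp (- ((d * t)\<^sup>2 / 2)) \<le> 2 * (1 / n * exp (- (d\<^sup>2 / 4 * t\<^sup>2)))"
        using D2 by (intro mult_mono) auto
      then have "2 * (?D * exp (- ((d * t)\<^sup>2 / 2))) \<le> (c * sqrt n) * (4 / (c * sqrt n * n) * exp (- (d\<^sup>2 / 4 * t\<^sup>2)))"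
        using c n0 by simp
      also have "\<dots> \<le> \<bar>t\<bar> * (4 / (c * sqrt n * n) * exp (- (d\<^sup>2 / 4 * t\<^sup>2)))"
        using False c by (intro mult_right_mono) auto
      also have "\<dots> \<le> \<bar>t\<bar> * G t"
        unfolding G_def using K by (intro mult_left_mono) auto
      finally show ?thesis using D by simp
    qed
  qed
  \<comment> \<open>The cutoff makes exp (- s^2 / 4) equal to 1 / sqrt n. Both \<open>d\<close> and
    \<open>s\<close> carry a factor sqrt (ln n), and their product is the source of the logarithmic
    loss.\<close>
  define s where "s = sqrt (2 * ln n)"
  have s0: "s \<ge> 0" using lnn by (simp add: s_def)
  have tail: "measure ?\<Phi> {g. \<bar>g\<bar> > s} \<le> sqrt 2 / sqrt n"
  proof -
    have "s\<^sup>2 / 4 = ln (sqrt n)" using lnn n by (simp add: s_def ln_sqrt)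
    then have "exp (- (s\<^sup>2 / 4)) = 1 / sqrt n" using n0 by (simp add: exp_minus inverse_eq_divide)
    then show ?thesis using std_normal_tail[OF s0] by simp
  qed
  have ds: "d * s = 2 * sqrt 2 / c * (ln n / sqrt n)"
    using lnn c n0 by (simp add: d_def s_def real_sqrt_mult field_simps)
  \<comment> \<open>Noise is added to \<open>N\<close>, the smoothed laws are exchanged, and the
    noise is removed from the normal law again; the first and the last move each cost one
    displacement and one tail.\<close>
  have "cdf N x \<le> cdf (gauss_smooth d N) (x + d * s) + measure ?\<Phi> {g. \<bar>g\<bar> > s}"
    using cdf_le_gauss_smooth[OF N, of d x s] d by simp
  also have "cdf (gauss_smooth d N) (x + d * s) \<le> cdf (gauss_smooth d ?\<Phi>) (x + d * s) + (LINT t|lborel. G t)"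
  proof -
    have "cdf (gauss_smooth d N) (x + d * s) - cdf (gauss_smooth d ?\<Phi>) (x + d * s) \<le> (LINT t|lborel. G t)"
      by (rule cdf_diff_le_char_diff)
        (use d Gint G0 bnd N real_dist_normal_dist in
          \<open>auto intro!: real_distribution_gauss_smooth gauss_smooth_singleton\<close>)
    then show ?thesis by simp
  qed
  also have "cdf (gauss_smooth d ?\<Phi>) (x + d * s) \<le> cdf ?\<Phi> (x + d * s + d * s) + measure ?\<Phi> {g. \<bar>g\<bar> > s}"
    using gauss_smooth_le_cdf[OF real_dist_normal_dist, of d "x + d * s" s] d by simp
  also have "cdf ?\<Phi> (x + d * s + d * s) \<le> cdf ?\<Phi> x + (x + d * s + d * s - x)"
    by (rule std_normal_cdf_lipschitz) (use d s0 in auto)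
  finally have "cdf N x \<le> cdf ?\<Phi> x + 2 * (d * s) + 2 * (sqrt 2 / sqrt n)
      + (128 * K * sqrt pi + 8 * sqrt pi) / sqrt n"
    using tail IG by linarith
  also have "\<dots> = cdf ?\<Phi> x + 4 * sqrt 2 / c * (ln n / sqrt n)
    + (2 * sqrt 2 + (128 * K * sqrt pi + 8 * sqrt pi)) * (1 / sqrt n)"
    unfolding ds by (simp add: add_divide_distrib algebra_simps)
  also have "\<dots> \<le> cdf ?\<Phi> x + 4 * sqrt 2 / c * (ln n / sqrt n)
    + (2 * sqrt 2 + (128 * K * sqrt pi + 8 * sqrt pi)) * (2 * (ln n / sqrt n))"
  proof (intro add_left_mono mult_left_mono)
    show "1 / sqrt n \<le> 2 * (ln n / sqrt n)"
      using lnn n0 by (simp add: field_simps)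
  qed (use K in auto)
  finally show ?thesis by (simp add: C_def algebra_simps)
qed

end

lemma char_distr_scale:
  assumes "real_distribution M"
  shows "char (distr M borel (\<lambda>x. k * x)) t = char M (k * t)"
proof -
  interpret real_distribution M by fact
  show ?thesis unfolding char_def by (subst integral_distr) (auto simp: mult_ac)
qed

text \<open>The sum of n independent copies is represented by any law whose characteristic function
  is the n-th power, so no sequence of random variables has to be constructed. \<open>C\<close> is
  chosen before \<open>n\<close>, \<open>N\<close> and \<open>x\<close>. The proof rescales by 1 /
  sqrt v to reach unit variance.\<close>

theorem berry_esseen_log:
  assumes M: "real_distribution M"
    and int3: "integrable M (\<lambda>x. \<bar>x\<bar> ^ 3)"
    and mean: "(LINT x|M. x) = 0"
    and var: "(LINT x|M. x\<^sup>2) = v" "v > 0"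
  shows "\<exists>C. \<forall>n\<ge>2. \<forall>N. real_distribution N \<longrightarrow> (\<forall>t. char N t = char M t ^ n) \<longrightarrow>
    (\<forall>x. cdf N x \<le> cdf std_normal_distribution (x / sqrt (n * v)) + C * (ln n / sqrt n))"
proof -
  interpret M: real_distribution M by fact
  let ?M = "distr M borel (\<lambda>x. 1 / sqrt v * x)"
  have 1: "real_distribution ?M" by (rule M.real_distribution_distr) simp
  have 2: "integrable ?M (\<lambda>x. \<bar>x\<bar> ^ 3)"
    using int3 by (subst integrable_distr_eq) (auto simp: abs_mult power_mult_distrib power_divide)
  have 3: "(LINT x|?M. x) = 0" using mean by (subst integral_distr) auto
  have 4: "(LINT x|?M. x\<^sup>2) = 1" using var by (subst integral_distr) (auto simp: power_divide)
  define C where "C = 2 * (128 * ((LINT x|?M. \<bar>x\<bar> ^ 3) / 6 + 1 / 8) * sqrt pi + 8 * sqrt pi) + 4 * sqrt 2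
    + 4 * sqrt 2 / (1 / (1 + (LINT x|?M. \<bar>x\<bar> ^ 3)))"
  show ?thesis
  proof (intro exI[of _ C] allI impI)
    fix n :: nat and N :: "real measure" and x :: real
    assume n: "2 \<le> n" and N: "real_distribution N" and char: "\<forall>t. char N t = char M t ^ n"
    interpret N: real_distribution N by fact
    let ?N = "distr N borel (\<lambda>x. 1 / sqrt (n * v) * x)"
    have nv: "sqrt (n * v) > 0" using n var by simp
    have "{x'. 1 / sqrt (n * v) * x' \<le> x / sqrt (n * v)} = {..x}"
      using nv by (auto simp: divide_le_cancel)
    then have "cdf N x = cdf ?N (x / sqrt (n * v))"
      by (simp add: cdf_def measure_distr vimage_def)
    also have "\<dots> \<le> cdf std_normal_distribution (x / sqrt (n * v)) + C * (ln n / sqrt n)"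
      unfolding C_def
    proof (rule berry_esseen_log_aux[OF 1 2 3 4 n])
      show "real_distribution ?N" by (rule N.real_distribution_distr) simp
      show "char ?N t = char ?M (t / sqrt n) ^ n" for t
        unfolding char_distr_scale[OF M] char_distr_scale[OF N]
        using char by (simp add: real_sqrt_mult mult_ac)
    qed
    finally show "cdf N x \<le> cdf std_normal_distribution (x / sqrt (n * v)) + C * (ln n / sqrt n)" .
  qed
qed

section \<open>The information density\<close>

lemma nn_integral_gaussian_complex:
  assumes "a > 0"
  shows "(\<integral>\<^sup>+z. ennreal (exp (- (a * (cmod z)\<^sup>2))) \<partial>lborel) = ennreal (pi / a)"
proof -
  have "(\<integral>\<^sup>+z. ennreal (exp (- (a * (cmod z)\<^sup>2))) \<partial>lborel)
    = (\<integral>\<^sup>+z. (\<Prod>b\<in>(Basis :: complex set). ennreal (exp (- (a * (z \<bullet> b)\<^sup>2)))) \<partial>lborel)"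
  proof (intro nn_integral_cong)
    fix z :: complex
    show "ennreal (exp (- (a * (cmod z)\<^sup>2))) = (\<Prod>b\<in>(Basis :: complex set). ennreal (exp (- (a * (z \<bullet> b)\<^sup>2))))"
      by (simp add: Basis_complex_def cmod_power2 ennreal_mult'[symmetric] exp_add[symmetric] algebra_simps)
  qed
  also have "\<dots> = (\<Prod>b\<in>(Basis :: complex set). \<integral>\<^sup>+x. ennreal (exp (- (a * x\<^sup>2))) \<partial>lborel)"
    by (rule nn_integral_lborel_prod) auto
  also have "(\<integral>\<^sup>+x. ennreal (exp (- (a * x\<^sup>2))) \<partial>lborel) = ennreal (sqrt (pi / a))"
    using integral_gaussian[OF assms] by (subst nn_integral_eq_integral) auto
  finally show ?thesis
    using assms by (simp add: Basis_complex_def ennreal_mult'[symmetric])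
qed

lemma prob_space_CN01: "prob_space CN01"
proof
  have "emeasure CN01 (space CN01) = (\<integral>\<^sup>+z. ennreal (1 / pi) * ennreal (exp (- (1 * (cmod z)\<^sup>2))) \<partial>lborel)"
    by (simp add: CN01_def emeasure_density ennreal_mult'[symmetric])
  also have "\<dots> = ennreal (1 / pi) * ennreal pi"
    by (subst nn_integral_cmult) (auto simp: nn_integral_gaussian_complex[of 1, simplified])
  finally show "emeasure CN01 (space CN01) = 1"
    by (simp add: ennreal_mult'[symmetric])
qed

lemma space_CN01 [simp]: "space CN01 = UNIV"
  by (simp add: CN01_def)

lemma sets_CN01 [simp, measurable_cong]: "sets CN01 = sets borel"
  by (simp add: CN01_def)

text \<open>Growth up to exp (|z|^2 / 2) uses only half of the decay exp (- |z|^2) of the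
  density.\<close>

lemma integrable_CN01:
  fixes f :: "complex \<Rightarrow> real"
  assumes [measurable]: "f \<in> borel_measurable borel"
    and bound: "\<And>z. \<bar>f z\<bar> \<le> C * exp ((cmod z)\<^sup>2 / 2)"
  shows "integrable CN01 f"
proof -
  have "integrable lborel (\<lambda>z. exp (- (1/2 * (cmod z)\<^sup>2)))"
    using nn_integral_gaussian_complex[of "1/2"]
    by (intro integrableI_nonneg) auto
  then have "integrable lborel (\<lambda>z. C / pi * exp (- (1/2 * (cmod z)\<^sup>2)))"
    by (rule integrable_mult_right)
  then have "integrable lborel (\<lambda>z. (1 / pi * exp (- (cmod z)\<^sup>2)) *\<^sub>R f z)"
  proof (rule Bochner_Integration.integrable_bound)
    show "AE z in lborel. norm ((1 / pi * exp (- (cmod z)\<^sup>2)) *\<^sub>R f z) \<le> norm (C / pi * exp (- (1/2 * (cmod z)\<^sup>2)))"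
    proof (intro AE_I2)
      fix z
      have "norm ((1 / pi * exp (- (cmod z)\<^sup>2)) *\<^sub>R f z) = 1 / pi * exp (- (cmod z)\<^sup>2) * \<bar>f z\<bar>"
        by (simp add: abs_mult)
      also have "\<dots> \<le> 1 / pi * exp (- (cmod z)\<^sup>2) * (C * exp ((cmod z)\<^sup>2 / 2))"
        by (rule mult_left_mono[OF bound]) simp
      also have "\<dots> = C / pi * (exp (- (cmod z)\<^sup>2) * exp ((cmod z)\<^sup>2 / 2))" by simp
      also have "\<dots> = C / pi * exp (- (1/2 * (cmod z)\<^sup>2))"
        by (simp only: exp_add[symmetric]) simp
      finally show "norm ((1 / pi * exp (- (cmod z)\<^sup>2)) *\<^sub>R f z) \<le> norm (C / pi * exp (- (1/2 * (cmod z)\<^sup>2)))"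
        by (metis abs_ge_self order_trans real_norm_def)
    qed
  qed simp
  then show ?thesis
    unfolding CN01_def by (subst integrable_density) auto
qed

lemma integrable_CN01_cube_bound:
  fixes f :: "complex \<Rightarrow> real"
  assumes "f \<in> borel_measurable borel"
    and bound: "\<And>z. \<bar>f z\<bar> \<le> A * (1 + (cmod z)\<^sup>2) ^ 3"
  shows "integrable CN01 f"
proof (rule integrable_CN01[of _ "A * 216 * exp (1/2)"])
  fix z
  \<comment> \<open>The divisor 6 makes 3 * \<open>?u\<close> equal to 1/2 + |z|^2 / 2, the growth
    that the Gaussian tolerates; cubing u \<le> exp u then gives the constant 216 = 6^3.\<close>
  let ?u = "(1 + (cmod z)\<^sup>2) / 6"
  have "0 \<le> A * 1" using order_trans[OF abs_ge_zero bound[of 0]] by simp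
  then have A: "A \<ge> 0" by simp
  have "?u \<le> exp ?u" using exp_ge_add_one_self[of ?u] by linarith
  then have "?u ^ 3 \<le> exp ?u ^ 3" by (intro power_mono) auto
  also have "\<dots> = exp (1/2) * exp ((cmod z)\<^sup>2 / 2)"
    by (simp only: exp_of_nat_mult[symmetric] exp_add[symmetric]) (simp add: add_divide_distrib)
  finally have "(1 + (cmod z)\<^sup>2) ^ 3 \<le> 216 * exp (1/2) * exp ((cmod z)\<^sup>2 / 2)"
    by (simp add: power_divide)
  then have "A * (1 + (cmod z)\<^sup>2) ^ 3 \<le> A * (216 * exp (1/2) * exp ((cmod z)\<^sup>2 / 2))"
    by (rule mult_left_mono[OF _ A])
  then show "\<bar>f z\<bar> \<le> A * 216 * exp (1/2) * exp ((cmod z)\<^sup>2 / 2)"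
    using bound[of z] by (simp add: mult_ac)
qed (rule assms(1))

lemma pmf_of_set_pair_integral:
  fixes f :: "'a \<times> 'b \<Rightarrow> 'c::{banach, second_countable_topology}"
  assumes A: "finite A" "A \<noteq> {}" and M: "prob_space M"
    and f [measurable]: "f \<in> borel_measurable (measure_pmf (pmf_of_set A) \<Otimes>\<^sub>M M)"
    and int: "\<And>x. x \<in> A \<Longrightarrow> integrable M (\<lambda>y. f (x, y))"
  shows "integrable (measure_pmf (pmf_of_set A) \<Otimes>\<^sub>M M) f"
    and "integral\<^sup>L (measure_pmf (pmf_of_set A) \<Otimes>\<^sub>M M) f
      = (1 / real (card A)) *\<^sub>R (\<Sum>x\<in>A. \<integral>y. f (x, y) \<partial>M)"
proof -
  interpret M: prob_space M by fact
  interpret P: pair_prob_space "measure_pmf (pmf_of_set A)" M ..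
  show i: "integrable (measure_pmf (pmf_of_set A) \<Otimes>\<^sub>M M) f"
  proof (rule P.Fubini_integrable)
    show "integrable (measure_pmf (pmf_of_set A)) (\<lambda>x. \<integral>y. norm (f (x, y)) \<partial>M)"
      using A by (intro integrable_measure_pmf_finite) simp
    show "AE x in measure_pmf (pmf_of_set A). integrable M (\<lambda>y. f (x, y))"
      using A int by (simp add: AE_measure_pmf_iff)
  qed simp
  have "integral\<^sup>L (measure_pmf (pmf_of_set A) \<Otimes>\<^sub>M M) f
    = (\<integral>x. (\<integral>y. f (x, y) \<partial>M) \<partial>measure_pmf (pmf_of_set A))"
    by (rule P.integral_fst'[OF i, symmetric])
  also have "\<dots> = (\<Sum>x\<in>A. pmf (pmf_of_set A) x *\<^sub>R (\<integral>y. f (x, y) \<partial>M))"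
    using A by (intro integral_measure_pmf) (auto simp: set_pmf_of_set)
  also have "\<dots> = (1 / real (card A)) *\<^sub>R (\<Sum>x\<in>A. \<integral>y. f (x, y) \<partial>M)"
    using A by (simp add: pmf_of_set indicator_def scaleR_sum_right)
  finally show "integral\<^sup>L (measure_pmf (pmf_of_set A) \<Otimes>\<^sub>M M) f
      = (1 / real (card A)) *\<^sub>R (\<Sum>x\<in>A. \<integral>y. f (x, y) \<partial>M)" .
qed

text \<open>\<open>(c, b) \<mapsto> (c(k := b), c k)\<close> is an involution: one codeword can be redrawn independently of the others.\<close>

lemma sum_PiE_resample:
  fixes f :: "('i \<Rightarrow> 'a) \<Rightarrow> real"
  assumes "k \<in> I"
  shows "(\<Sum>c\<in>I \<rightarrow>\<^sub>E A. \<Sum>b\<in>A. f (c(k := b))) = real (card A) * (\<Sum>c\<in>I \<rightarrow>\<^sub>E A. f c)"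
proof -
  have "(\<Sum>c\<in>I \<rightarrow>\<^sub>E A. \<Sum>b\<in>A. f (c(k := b))) = (\<Sum>(c, b)\<in>(I \<rightarrow>\<^sub>E A) \<times> A. f (c(k := b)))"
    by (rule sum.cartesian_product)
  also have "\<dots> = (\<Sum>(c, b)\<in>(I \<rightarrow>\<^sub>E A) \<times> A. f c)"
    by (rule sum.reindex_bij_witness[where i = "\<lambda>(c, b). (c(k := b), c k)" and j = "\<lambda>(c, b). (c(k := b), c k)"])
      (use assms in \<open>auto simp: fun_upd_idem PiE_def extensional_def Pi_def\<close>)
  also have "\<dots> = (\<Sum>c\<in>I \<rightarrow>\<^sub>E A. \<Sum>b\<in>A. f c)"
    by (rule sum.cartesian_product[symmetric])
  finally show ?thesis by (simp add: sum_distrib_left)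
qed

section \<open>The Q-function and its inverse\<close>

lemma Qfun_eq_cdf: "Qfun x = cdf std_normal_distribution (- x)"
proof -
  have "Qfun x = (LINT t|lborel. indicator {x..} t * std_normal_density t)"
    by (simp add: Qfun_def set_lebesgue_integral_def std_normal_density_def)
  also have "\<dots> = (LINT t|lborel. indicator {x..} (- t) * std_normal_density (- t))"
    using lborel_integral_real_affine[of "-1" "\<lambda>t. indicator {x..} t * std_normal_density t" 0] by simp
  also have "\<dots> = (LINT t|lborel. std_normal_density t * indicator {..- x} t)"
    by (intro Bochner_Integration.integral_cong) (auto simp: std_normal_density_def split: split_indicator)
  also have "\<dots> = (LINT t|std_normal_distribution. indicator {..- x} t)"
    by (subst integral_density) auto
  also have "\<dots> = cdf std_normal_distribution (- x)"
    by (simp add: cdf_def)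
  finally show ?thesis .
qed

text \<open>\<open>inv\<close> returns some preimage as soon as there is one, so the point is that
  \<open>e\<close> lies in the range of \<open>Qfun\<close>. The intermediate value theorem provides
  this, with continuity coming from the absence of atoms.\<close>

lemma cdf_Qinv:
  assumes "0 < e" "e < 1"
  shows "cdf std_normal_distribution (- Qinv e) = e"
proof -
  interpret N: real_distribution std_normal_distribution by (rule real_dist_normal_dist)
  let ?F = "cdf std_normal_distribution"
  have "measure std_normal_distribution {x} = 0" for x
  proof -
    have "emeasure std_normal_distribution {x} = 0"
      by (simp add: emeasure_density nn_integral_0_iff_AE AE_lborel_singleton split: split_indicator)
    then show ?thesis by (simp add: measure_def)
  qed
  then have cont: "isCont ?F x" for x by (simp add: N.isCont_cdf)
  have "eventually (\<lambda>x. ?F x < e) at_bot"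
    by (rule order_tendstoD(2)[OF N.cdf_lim_at_bot assms(1)])
  then obtain a where a: "?F a < e" by (auto simp: eventually_at_bot_linorder)
  have "eventually (\<lambda>x. e < ?F x) at_top"
    by (rule order_tendstoD(1)[OF N.cdf_lim_at_top_prob assms(2)])
  then obtain b where b: "e < ?F b" by (auto simp: eventually_at_top_linorder)
  have "a \<le> b" using a b N.cdf_nondecreasing[of b a] by linarith
  then obtain x where "?F x = e"
    using IVT'[of ?F a e b] a b cont by (auto intro: continuous_at_imp_continuous_on)
  then have "Qfun (- x) = e" by (simp add: Qfun_eq_cdf)
  then have "Qfun (Qinv e) = e"
    unfolding Qinv_def by (intro f_inv_into_f) auto
  then show ?thesis by (simp add: Qfun_eq_cdf)
qed

section \<open>Moments of the single-letter information density\<close>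

locale tin_channel =
  fixes h :: complex and X1 X21 :: "complex set"
  assumes X1: "finite X1" "X1 \<noteq> {}" and X21: "finite X21" "X21 \<noteq> {}"
begin

abbreviation "info \<equiv> info_density h X1 X21"
abbreviation "MI \<equiv> mutual_info h X1 X21"

text \<open>This is \<open>card X21\<close> times the transition density seen when the interference
  is averaged out; the factor cancels in the information density.\<close>

definition W :: "complex \<Rightarrow> complex \<Rightarrow> real" where
  "W x y = (\<Sum>x2\<in>X21. chan_density h y x x2)"

lemma card_pos: "real (card X1) > 0" "real (card X21) > 0"
  using X1 X21 by (auto simp: card_gt_0_iff)

lemma W_pos: "W x y > 0"
  unfolding W_def chan_density_def using X21 by (intro sum_pos) auto

lemma sum_W_pos: "(\<Sum>x\<in>X1. W x y) > 0"
  using X1 W_pos by (intro sum_pos) auto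

lemma info_eq_W: "info x y = log 2 (W x y / ((\<Sum>x'\<in>X1. W x' y) / real (card X1)))"
  unfolding info_density_def W_def
  by (simp add: sum_divide_distrib)

lemma info_measurable [measurable (raw)]:
  assumes [measurable]: "f \<in> borel_measurable M" "g \<in> borel_measurable M"
  shows "(\<lambda>x. info (f x) (g x)) \<in> borel_measurable M"
  unfolding info_density_def chan_density_def by measurable

lemma Lratio_measurable [measurable]: "Lratio h X1 X21 x1 x2 \<in> borel_measurable borel"
  unfolding Lratio_def by measurable

lemma W_received:
  "W x (h * (x1 + x2) + z)
    = 1 / pi * (\<Sum>x2'\<in>X21. exp (- (cmod (z + h * (x1 - x + x2 - x2')))\<^sup>2))"
  unfolding W_def chan_density_def sum_distrib_left
  by (intro sum.cong refl arg_cong2[where f = "(*)"] arg_cong[where f = exp] arg_cong[where f = uminus]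
        arg_cong[where f = "\<lambda>u. u\<^sup>2"] arg_cong[where f = cmod])
    (simp add: algebra_simps)

text \<open>For \<open>x1\<close> in \<open>X1\<close>, \<open>Lratio\<close> is thus the reciprocal
  of the posterior probability of \<open>x1\<close> given the received value under the uniform
  prior, which links the stated formulas to the information density.\<close>

lemma Lratio_eq_W:
  defines "y \<equiv> \<lambda>x1 x2 z. h * (x1 + x2) + z"
  shows "Lratio h X1 X21 x1 x2 z = (\<Sum>x\<in>X1. W x (y x1 x2 z)) / W x1 (y x1 x2 z)"
  unfolding y_def W_received Lratio_def sum_distrib_left[symmetric] by simp

lemma info_density_Lratio:
  "info x1 (h * (x1 + x2) + z) = log 2 (real (card X1)) - log 2 (Lratio h X1 X21 x1 x2 z)"
  unfolding info_eq_W Lratio_eq_W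
  using W_pos[of x1 "h * (x1 + x2) + z"] sum_W_pos[of "h * (x1 + x2) + z"] card_pos
  by (simp add: log_divide log_mult)

lemma Lratio_ge_1:
  assumes "x1 \<in> X1"
  shows "1 \<le> Lratio h X1 X21 x1 x2 z"
proof -
  let ?y = "h * (x1 + x2) + z"
  have "W x1 ?y \<le> (\<Sum>x\<in>X1. W x ?y)"
    using X1 assms W_pos by (intro member_le_sum) (auto intro: less_imp_le)
  then show ?thesis unfolding Lratio_eq_W using W_pos[of x1 ?y] by simp
qed

text \<open>Every term of the numerator is at most 1, and the denominator contains the term of the
  true interference symbol, exp (- |z|^2). With \<open>Lratio_ge_1\<close> the logarithm lies
  between 0 and a quadratic in |z|, so all required moments are finite.\<close>

lemma Lratio_le:
  assumes "x2 \<in> X21"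
  shows "Lratio h X1 X21 x1 x2 z \<le> real (card X1) * real (card X21) * exp ((cmod z)\<^sup>2)"
proof -
  let ?n = "\<Sum>x1'\<in>X1. \<Sum>x21'\<in>X21. exp (- (cmod (z + h * (x1 - x1' + x2 - x21')))\<^sup>2)"
  let ?d = "\<Sum>x21'\<in>X21. exp (- (cmod (z + h * (x2 - x21')))\<^sup>2)"
  have n: "?n \<le> (\<Sum>x1'\<in>X1. \<Sum>x21'\<in>X21. 1)"
    by (intro sum_mono) simp
  have "exp (- (cmod (z + h * (x2 - x2)))\<^sup>2) \<le> ?d"
    using X21 assms by (intro member_le_sum[where f = "\<lambda>x. exp (- (cmod (z + h * (x2 - x)))\<^sup>2)"]) auto
  then have d: "exp (- (cmod z)\<^sup>2) \<le> ?d" by simp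
  have "?n / ?d \<le> (\<Sum>x1'\<in>X1. \<Sum>x21'\<in>X21. 1) / exp (- (cmod z)\<^sup>2)"
    by (intro frac_le n d) (auto intro!: sum_nonneg)
  then show ?thesis unfolding Lratio_def by (simp add: exp_minus divide_inverse)
qed

definition log_bound :: real where
  "log_bound = \<bar>log 2 (real (card X1) * real (card X21))\<bar> + 1 / ln 2"

lemma abs_log_Lratio_le:
  assumes "x1 \<in> X1" "x2 \<in> X21"
  shows "\<bar>log 2 (Lratio h X1 X21 x1 x2 z)\<bar> \<le> log_bound * (1 + (cmod z)\<^sup>2)"
proof -
  have 1: "1 \<le> Lratio h X1 X21 x1 x2 z" by (rule Lratio_ge_1[OF assms(1)])
  then have "\<bar>log 2 (Lratio h X1 X21 x1 x2 z)\<bar> = log 2 (Lratio h X1 X21 x1 x2 z)"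
    by simp
  also have "\<dots> \<le> log 2 (real (card X1) * real (card X21) * exp ((cmod z)\<^sup>2))"
    using 1 Lratio_le[OF assms(2), of x1 z] by (intro log_mono) auto
  also have "\<dots> = log 2 (real (card X1) * real (card X21)) + (cmod z)\<^sup>2 / ln 2"
    using card_pos by (subst log_mult) (auto simp: log_def)
  also have "\<dots> \<le> \<bar>log 2 (real (card X1) * real (card X21))\<bar> * (1 + (cmod z)\<^sup>2) + (1 + (cmod z)\<^sup>2) / ln 2"
  proof (intro add_mono divide_right_mono)
    have "\<bar>log 2 (real (card X1) * real (card X21))\<bar> * 1
        \<le> \<bar>log 2 (real (card X1) * real (card X21))\<bar> * (1 + (cmod z)\<^sup>2)"
      by (rule mult_left_mono) auto
    then show "log 2 (real (card X1) * real (card X21))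
        \<le> \<bar>log 2 (real (card X1) * real (card X21))\<bar> * (1 + (cmod z)\<^sup>2)" by linarith
  qed auto
  also have "\<dots> = log_bound * (1 + (cmod z)\<^sup>2)"
    unfolding log_bound_def by (simp add: distrib_right)
  finally show ?thesis .
qed

lemma log_bound_pos: "log_bound > 0"
  unfolding log_bound_def by (intro add_nonneg_pos) auto

text \<open>The affine form covers both the moments of log L (c = 0, s = 1) and those of the centred
  information density (s = -1); k = 3 is the moment that the normal approximation needs.\<close>

lemma integrable_CN01_polynomial:
  assumes x: "x1 \<in> X1" "x2 \<in> X21" and k: "k \<le> 3"
  shows "integrable CN01 (\<lambda>z. (c + s * log 2 (Lratio h X1 X21 x1 x2 z)) ^ k)"
proof (rule integrable_CN01_cube_bound)
  let ?A = "\<bar>c\<bar> + \<bar>s\<bar> * log_bound"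
  fix z
  have u: "1 \<le> 1 + (cmod z)\<^sup>2" by simp
  have "\<bar>c + s * log 2 (Lratio h X1 X21 x1 x2 z)\<bar> \<le> \<bar>c\<bar> + \<bar>s\<bar> * \<bar>log 2 (Lratio h X1 X21 x1 x2 z)\<bar>"
    by (metis abs_mult abs_triangle_ineq)
  also have "\<dots> \<le> \<bar>c\<bar> * (1 + (cmod z)\<^sup>2) + \<bar>s\<bar> * (log_bound * (1 + (cmod z)\<^sup>2))"
    by (intro add_mono mult_left_mono abs_log_Lratio_le x mult_right_mono) (auto simp: algebra_simps)
  also have "\<dots> = ?A * (1 + (cmod z)\<^sup>2)" by (simp add: algebra_simps)
  finally have b: "\<bar>c + s * log 2 (Lratio h X1 X21 x1 x2 z)\<bar> \<le> ?A * (1 + (cmod z)\<^sup>2)" .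
  have A: "?A \<ge> 0" using log_bound_pos by simp
  have "\<bar>c + s * log 2 (Lratio h X1 X21 x1 x2 z)\<bar> ^ k \<le> (?A * (1 + (cmod z)\<^sup>2)) ^ k"
    by (rule power_mono[OF b]) simp
  also have "\<dots> = ?A ^ k * (1 + (cmod z)\<^sup>2) ^ k" by (rule power_mult_distrib)
  also have "\<dots> \<le> ?A ^ k * (1 + (cmod z)\<^sup>2) ^ 3"
    using A by (intro mult_left_mono power_increasing[OF k u]) auto
  finally show "\<bar>(c + s * log 2 (Lratio h X1 X21 x1 x2 z)) ^ k\<bar> \<le> ?A ^ k * (1 + (cmod z)\<^sup>2) ^ 3"
    by (simp add: power_abs)
qed simp

lemma prob_space_symbol_law: "prob_space (symbol_law X1 X21)"
proof -
  interpret C: prob_space CN01 by (rule prob_space_CN01)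
  interpret P: pair_prob_space "measure_pmf (pmf_of_set X21)" CN01 ..
  interpret Q: pair_prob_space "measure_pmf (pmf_of_set X1)" "measure_pmf (pmf_of_set X21) \<Otimes>\<^sub>M CN01" ..
  show ?thesis unfolding symbol_law_def by unfold_locales
qed

lemma
  fixes f :: "complex \<times> complex \<times> complex \<Rightarrow> 'c::{banach, second_countable_topology}"
  assumes f: "f \<in> borel_measurable (symbol_law X1 X21)"
    and int: "\<And>x1 x2. x1 \<in> X1 \<Longrightarrow> x2 \<in> X21 \<Longrightarrow> integrable CN01 (\<lambda>z. f (x1, x2, z))"
  shows integrable_symbol_law: "integrable (symbol_law X1 X21) f"
    and integral_symbol_law: "integral\<^sup>L (symbol_law X1 X21) f
      = (1 / (real (card X1) * real (card X21))) *\<^sub>R (\<Sum>x1\<in>X1. \<Sum>x2\<in>X21. \<integral>z. f (x1, x2, z) \<partial>CN01)"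
proof -
  interpret C: prob_space CN01 by (rule prob_space_CN01)
  interpret P: pair_prob_space "measure_pmf (pmf_of_set X21)" CN01 ..
  have fx: "(\<lambda>p. f (x1, p)) \<in> borel_measurable (measure_pmf (pmf_of_set X21) \<Otimes>\<^sub>M CN01)" for x1
    using measurable_Pair2[OF f[unfolded symbol_law_def], of x1] by simp
  note inner = pmf_of_set_pair_integral[OF X21 prob_space_CN01 fx int]
  note outer = pmf_of_set_pair_integral[OF X1 P.prob_space_axioms f[unfolded symbol_law_def] inner(1)]
  show "integrable (symbol_law X1 X21) f"
    unfolding symbol_law_def by (rule outer(1))
  have "integral\<^sup>L (symbol_law X1 X21) f = (1 / real (card X1)) *\<^sub>R
      (\<Sum>x1\<in>X1. (1 / real (card X21)) *\<^sub>R (\<Sum>x2\<in>X21. \<integral>z. f (x1, x2, z) \<partial>CN01))"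
    unfolding symbol_law_def using outer(2) inner(2) by (simp cong: sum.cong)
  then show "integral\<^sup>L (symbol_law X1 X21) f
      = (1 / (real (card X1) * real (card X21))) *\<^sub>R (\<Sum>x1\<in>X1. \<Sum>x2\<in>X21. \<integral>z. f (x1, x2, z) \<partial>CN01)"
    by (simp add: scaleR_sum_right)
qed

definition avg :: "(complex \<Rightarrow> complex \<Rightarrow> complex \<Rightarrow> real) \<Rightarrow> real" where
  "avg f = 1 / (real (card X1) * real (card X21)) * (\<Sum>x1\<in>X1. \<Sum>x2\<in>X21. LINT z|CN01. f x1 x2 z)"

lemma avg_add_scaled:
  assumes "\<And>x1 x2. x1 \<in> X1 \<Longrightarrow> x2 \<in> X21 \<Longrightarrow> integrable CN01 (f x1 x2)"
    and "\<And>x1 x2. x1 \<in> X1 \<Longrightarrow> x2 \<in> X21 \<Longrightarrow> integrable CN01 (g x1 x2)"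
  shows "avg (\<lambda>x1 x2 z. f x1 x2 z + s * g x1 x2 z) = avg f + s * avg g"
proof -
  have "(\<Sum>x1\<in>X1. \<Sum>x2\<in>X21. LINT z|CN01. f x1 x2 z + s * g x1 x2 z)
    = (\<Sum>x1\<in>X1. \<Sum>x2\<in>X21. (LINT z|CN01. f x1 x2 z) + s * (LINT z|CN01. g x1 x2 z))"
    using assms by (intro sum.cong refl) (simp add: Bochner_Integration.integral_add)
  then show ?thesis
    unfolding avg_def by (simp add: sum.distrib sum_distrib_left[symmetric] algebra_simps add_divide_distrib)
qed

lemma avg_const: "avg (\<lambda>_ _ _. c) = c"
proof -
  interpret C: prob_space CN01 by (rule prob_space_CN01)
  show ?thesis using card_pos C.prob_space by (simp add: avg_def)
qed

lemma info_symbol_measurable [measurable]: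
  "(\<lambda>(x1, x2, z). info x1 (h * (x1 + x2) + z)) \<in> borel_measurable (symbol_law X1 X21)"
proof -
  let ?P = "measure_pmf (pmf_of_set X1)" and ?Q = "measure_pmf (pmf_of_set X21)"
  have 1: "fst \<in> borel_measurable (?P \<Otimes>\<^sub>M (?Q \<Otimes>\<^sub>M CN01))"
    by (rule measurable_compose[OF measurable_fst]) simp
  have 2: "(\<lambda>p. fst (snd p)) \<in> borel_measurable (?P \<Otimes>\<^sub>M (?Q \<Otimes>\<^sub>M CN01))"
    by (rule measurable_compose[OF measurable_snd], rule measurable_compose[OF measurable_fst]) simp
  have 3: "(\<lambda>p. snd (snd p)) \<in> borel_measurable (?P \<Otimes>\<^sub>M (?Q \<Otimes>\<^sub>M CN01))"
    by (rule measurable_compose[OF measurable_snd], rule measurable_compose[OF measurable_snd]) simp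
  show ?thesis unfolding symbol_law_def case_prod_unfold
    by (intro info_measurable borel_measurable_add borel_measurable_times borel_measurable_const 1 2 3)
qed

lemma integral_symbol_law_polynomial:
  assumes "k \<le> 3"
  shows "integrable (symbol_law X1 X21) (\<lambda>(x1, x2, z). (info x1 (h * (x1 + x2) + z) - c) ^ k)"
    and "(LINT (x1, x2, z)|symbol_law X1 X21. (info x1 (h * (x1 + x2) + z) - c) ^ k)
      = avg (\<lambda>x1 x2 z. (log 2 (real (card X1)) - c - log 2 (Lratio h X1 X21 x1 x2 z)) ^ k)"
proof -
  have int: "integrable CN01 (\<lambda>z. (log 2 (real (card X1)) - c - log 2 (Lratio h X1 X21 x1 x2 z)) ^ k)"
    if "x1 \<in> X1" "x2 \<in> X21" for x1 x2
    using integrable_CN01_polynomial[OF that assms, of "log 2 (real (card X1)) - c" "-1"] by simp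
  have eq: "info x1 (h * (x1 + x2) + z) - c = log 2 (real (card X1)) - c - log 2 (Lratio h X1 X21 x1 x2 z)"
    for x1 x2 z by (simp add: info_density_Lratio)
  have m: "(\<lambda>(x1, x2, z). (info x1 (h * (x1 + x2) + z) - c) ^ k) \<in> borel_measurable (symbol_law X1 X21)"
  proof -
    have "(\<lambda>p. ((\<lambda>(x1, x2, z). info x1 (h * (x1 + x2) + z)) p - c) ^ k) \<in> borel_measurable (symbol_law X1 X21)"
      by measurable
    then show ?thesis by (simp add: case_prod_unfold)
  qed
  show "integrable (symbol_law X1 X21) (\<lambda>(x1, x2, z). (info x1 (h * (x1 + x2) + z) - c) ^ k)"
    by (rule integrable_symbol_law[OF m]) (use int in \<open>simp add: eq\<close>)
  show "(LINT (x1, x2, z)|symbol_law X1 X21. (info x1 (h * (x1 + x2) + z) - c) ^ k)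
      = avg (\<lambda>x1 x2 z. (log 2 (real (card X1)) - c - log 2 (Lratio h X1 X21 x1 x2 z)) ^ k)"
    by (subst integral_symbol_law[OF m]) (use int in \<open>simp_all add: eq avg_def\<close>)
qed

lemma integrable_log_Lratio:
  assumes "x1 \<in> X1" "x2 \<in> X21"
  shows "integrable CN01 (\<lambda>z. log 2 (Lratio h X1 X21 x1 x2 z))"
    and "integrable CN01 (\<lambda>z. (log 2 (Lratio h X1 X21 x1 x2 z))\<^sup>2)"
  using integrable_CN01_polynomial[OF assms, of 1 0 1] integrable_CN01_polynomial[OF assms, of 2 0 1]
  by auto

lemma mutual_info_eq:
  "MI = log 2 (real (card X1)) - avg (\<lambda>x1 x2 z. log 2 (Lratio h X1 X21 x1 x2 z))"
proof -
  interpret C: prob_space CN01 by (rule prob_space_CN01)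
  have "MI = avg (\<lambda>x1 x2 z. log 2 (real (card X1)) + (-1) * log 2 (Lratio h X1 X21 x1 x2 z))"
    using integral_symbol_law_polynomial(2)[of 1 0] by (simp add: mutual_info_def)
  also have "\<dots> = log 2 (real (card X1)) - avg (\<lambda>x1 x2 z. log 2 (Lratio h X1 X21 x1 x2 z))"
    by (subst avg_add_scaled) (auto simp: integrable_log_Lratio avg_const)
  finally show ?thesis .
qed

text \<open>The constant log |X1| drops out on centring, so the dispersion is the variance of log L;
  expanding the square leaves second moment minus squared mean.\<close>

lemma dispersion_eq:
  "dispersion h X1 X21 = avg (\<lambda>x1 x2 z. (log 2 (Lratio h X1 X21 x1 x2 z))\<^sup>2)
    - (avg (\<lambda>x1 x2 z. log 2 (Lratio h X1 X21 x1 x2 z)))\<^sup>2"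
proof -
  interpret C: prob_space CN01 by (rule prob_space_CN01)
  let ?a = "avg (\<lambda>x1 x2 z. log 2 (Lratio h X1 X21 x1 x2 z))"
  let ?l = "\<lambda>x1 x2 z. log 2 (Lratio h X1 X21 x1 x2 z)"
  have "dispersion h X1 X21 = avg (\<lambda>x1 x2 z. (?a - ?l x1 x2 z)\<^sup>2)"
    using integral_symbol_law_polynomial(2)[of 2 MI] by (simp add: dispersion_def mutual_info_eq)
  also have "(\<lambda>x1 x2 z. (?a - ?l x1 x2 z)\<^sup>2) = (\<lambda>x1 x2 z. (?a\<^sup>2 + (- 2 * ?a) * ?l x1 x2 z) + 1 * (?l x1 x2 z)\<^sup>2)"
    by (simp add: fun_eq_iff power2_eq_square algebra_simps)
  also have "avg \<dots> = ?a\<^sup>2 + (- 2 * ?a) * ?a + 1 * avg (\<lambda>x1 x2 z. (?l x1 x2 z)\<^sup>2)"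
    by (subst avg_add_scaled, simp add: integrable_log_Lratio, simp add: integrable_log_Lratio,
        subst avg_add_scaled, simp, simp add: integrable_log_Lratio, simp add: avg_const)
  also have "\<dots> = avg (\<lambda>x1 x2 z. (?l x1 x2 z)\<^sup>2) - ?a\<^sup>2"
    by (simp add: power2_eq_square)
  finally show ?thesis .
qed

definition symbol_info :: "complex \<times> complex \<times> complex \<Rightarrow> real" where
  "symbol_info = (\<lambda>(x1, x2, z). info x1 (h * (x1 + x2) + z) - MI)"

lemma symbol_info_measurable [measurable]: "symbol_info \<in> borel_measurable (symbol_law X1 X21)"
proof -
  have "(\<lambda>p. (\<lambda>(x1, x2, z). info x1 (h * (x1 + x2) + z)) p - MI) \<in> borel_measurable (symbol_law X1 X21)"
    by measurable
  then show ?thesis by (simp add: symbol_info_def case_prod_unfold)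
qed

definition symbol_info_law :: "real measure" where
  "symbol_info_law = distr (symbol_law X1 X21) borel symbol_info"

lemma real_distribution_symbol_info_law: "real_distribution symbol_info_law"
  unfolding symbol_info_law_def
  by (rule prob_space.real_distribution_distr[OF prob_space_symbol_law]) simp

lemma symbol_info_law_moments:
  "integrable symbol_info_law (\<lambda>x. \<bar>x\<bar> ^ 3)"
  "(LINT x|symbol_info_law. x) = 0"
  "(LINT x|symbol_info_law. x\<^sup>2) = dispersion h X1 X21"
  "integrable symbol_info_law (\<lambda>x. x\<^sup>2)"
proof -
  interpret S: prob_space "symbol_law X1 X21" by (rule prob_space_symbol_law)
  have p: "integrable (symbol_law X1 X21) (\<lambda>x. symbol_info x ^ k)" if "k \<le> 3" for k
    using integral_symbol_law_polynomial(1)[OF that, of MI]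
    by (simp add: symbol_info_def case_prod_unfold)
  have "integrable (symbol_law X1 X21) (\<lambda>x. \<bar>symbol_info x ^ 3\<bar>)"
    using p[of 3] by (intro integrable_abs) simp
  then show "integrable symbol_info_law (\<lambda>x. \<bar>x\<bar> ^ 3)"
    unfolding symbol_info_law_def by (subst integrable_distr_eq) (auto simp: power_abs)
  show "integrable symbol_info_law (\<lambda>x. x\<^sup>2)"
    unfolding symbol_info_law_def using p[of 2] by (subst integrable_distr_eq) auto
  show "(LINT x|symbol_info_law. x\<^sup>2) = dispersion h X1 X21"
    unfolding symbol_info_law_def dispersion_def
    by (subst integral_distr[OF symbol_info_measurable]) (auto simp: symbol_info_def case_prod_unfold)
  have i: "integrable (symbol_law X1 X21) (\<lambda>(x1, x2, z). info x1 (h * (x1 + x2) + z))"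
    using integral_symbol_law_polynomial(1)[of 1 0] by simp
  have "(LINT x|symbol_info_law. x) = (LINT x|symbol_law X1 X21. (\<lambda>(x1, x2, z). info x1 (h * (x1 + x2) + z)) x - MI)"
    unfolding symbol_info_law_def
    by (subst integral_distr[OF symbol_info_measurable]) (auto simp: symbol_info_def case_prod_unfold)
  also have "\<dots> = MI - MI"
    using i by (subst Bochner_Integration.integral_diff) (auto simp: mutual_info_def S.prob_space)
  finally show "(LINT x|symbol_info_law. x) = 0" by simp
qed

section \<open>Words of length N: decoding rule and law of the information density\<close>

definition words :: "nat \<Rightarrow> (nat \<Rightarrow> complex) set" where
  "words N = {..<N} \<rightarrow>\<^sub>E X1"

definition word_info :: "nat \<Rightarrow> (nat \<Rightarrow> complex) \<Rightarrow> (nat \<Rightarrow> complex) \<Rightarrow> real" where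
  "word_info N b y = (\<Sum>j<N. info (b j) (y j))"

definition received :: "(nat \<Rightarrow> complex) \<Rightarrow> (nat \<Rightarrow> complex) \<Rightarrow> (nat \<Rightarrow> complex) \<Rightarrow> nat \<Rightarrow> complex" where
  "received a x2 z = (\<lambda>j. h * (a j + x2 j) + z j)"

text \<open>One uniform word instead of a whole codebook: under random coding the transmitted
  codeword is uniform on \<open>words N\<close> and independent of the disturbance.\<close>

definition transmission_law :: "nat \<Rightarrow> ((nat \<Rightarrow> complex) \<times> (nat \<Rightarrow> complex) \<times> (nat \<Rightarrow> complex)) measure" where
  "transmission_law N = measure_pmf (pmf_of_set (words N)) \<Otimes>\<^sub>M disturbance_law X21 N"

lemma words: "finite (words N)" "words N \<noteq> {}" "card (words N) = card X1 ^ N"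
  unfolding words_def using X1 by (auto simp: finite_PiE PiE_eq_empty_iff card_PiE)

lemma powr_word_info:
  "2 powr word_info N b y = (\<Prod>j<N. W (b j) (y j) / ((\<Sum>x\<in>X1. W x (y j)) / real (card X1)))"
proof -
  have "2 powr word_info N b y = (\<Prod>j<N. 2 powr info (b j) (y j))"
    unfolding word_info_def by (simp add: powr_sum)
  also have "\<dots> = (\<Prod>j<N. W (b j) (y j) / ((\<Sum>x\<in>X1. W x (y j)) / real (card X1)))"
    unfolding info_eq_W
    by (intro prod.cong refl powr_log_cancel divide_pos_pos W_pos sum_W_pos card_pos) auto
  finally show ?thesis .
qed

text \<open>The sum over words of a product over positions is a product of sums over
  \<open>X1\<close>, and in each position the numerators add up to the normalising
  denominator.\<close>

lemma sum_powr_word_info: "(\<Sum>b\<in>words N. 2 powr word_info N b y) = real (card (words N))"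
proof -
  have "(\<Sum>b\<in>words N. 2 powr word_info N b y)
    = (\<Prod>j<N. \<Sum>x\<in>X1. W x (y j) / ((\<Sum>x\<in>X1. W x (y j)) / real (card X1)))"
    unfolding powr_word_info words_def using X1 by (subst prod_sum_PiE) auto
  also have "\<dots> = (\<Prod>j<N. real (card X1))"
    using sum_W_pos card_pos
    by (intro prod.cong refl)
      (simp add: sum_divide_distrib[symmetric] sum_distrib_right[symmetric] less_imp_neq[symmetric])
  finally show ?thesis by (simp add: words)
qed

text \<open>The metric equals \<open>2 powr word_info\<close> times a positive factor depending on
  the received word alone, so the likelihood decoder maximises the information density.\<close>

lemma tin_metric_mono_iff:
  "tin_metric h X21 N a y \<le> tin_metric h X21 N b y \<longleftrightarrow> word_info N a y \<le> word_info N b y"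
proof -
  define K where "K = (\<Prod>j<N. 1 / real (card X21) * ((\<Sum>x\<in>X1. W x (y j)) / real (card X1)))"
  have K: "K > 0" unfolding K_def using sum_W_pos card_pos by (intro prod_pos) auto
  have "tin_metric h X21 N b y = 2 powr word_info N b y * K" for b
    unfolding K_def powr_word_info prod.distrib[symmetric] tin_metric_def W_def[symmetric]
    using sum_W_pos card_pos
    by (intro prod.cong refl) (simp add: less_imp_neq[symmetric])
  then show ?thesis using K by simp
qed

text \<open>The decoder outputs a maximiser of the information density. If this is not
  \<open>w\<close> and the value of \<open>w\<close> exceeds \<open>L\<close>, then the output is
  itself a competitor above \<open>L\<close>; how ties are broken is irrelevant.\<close>

lemma tin_decode_error:
  assumes "w < M" and "tin_decode h X21 N M c y \<noteq> w"
  shows "word_info N (c w) y \<le> L \<or> (\<exists>w'\<in>{..<M} - {w}. L < word_info N (c w') y)"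
proof -
  let ?m = "\<lambda>v. tin_metric h X21 N (c v) y"
  let ?P = "\<lambda>v. v < M \<and> (\<forall>w'<M. ?m w' \<le> ?m v)"
  \<comment> \<open>\<open>LEAST\<close> is meaningful only if some message attains the
    maximum.\<close>
  have "Max (?m ` {..<M}) \<in> ?m ` {..<M}"
    using assms by (intro Max_in) auto
  then obtain v where "v < M" "?m v = Max (?m ` {..<M})" by auto
  then have "?P v" by (auto intro: Max_ge)
  then have "?P (tin_decode h X21 N M c y)"
    unfolding tin_decode_def by (rule LeastI)
  then show ?thesis
    using assms by (force simp: tin_metric_mono_iff)
qed

lemma disturbance_measurable:
  assumes "j < N"
  shows "(\<lambda>p. fst p j) \<in> borel_measurable (disturbance_law X21 N)"
    and "(\<lambda>p. snd p j) \<in> borel_measurable (disturbance_law X21 N)"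
proof -
  let ?A = "\<Pi>\<^sub>M j\<in>{..<N}. measure_pmf (pmf_of_set X21)" and ?B = "\<Pi>\<^sub>M j\<in>{..<N}. CN01"
  have "(\<lambda>x. x j) \<in> ?A \<rightarrow>\<^sub>M measure_pmf (pmf_of_set X21)"
    using assms by (intro measurable_component_singleton) simp
  then have "(\<lambda>x. x j) \<in> borel_measurable ?A"
    by (rule measurable_compose) simp
  then show "(\<lambda>p. fst p j) \<in> borel_measurable (disturbance_law X21 N)"
    unfolding disturbance_law_def by (rule measurable_compose[OF measurable_fst])
  have "(\<lambda>x. x j) \<in> ?B \<rightarrow>\<^sub>M CN01"
    using assms by (intro measurable_component_singleton) simp
  then have "(\<lambda>x. x j) \<in> borel_measurable ?B"
    by (simp cong: measurable_cong_sets)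
  then show "(\<lambda>p. snd p j) \<in> borel_measurable (disturbance_law X21 N)"
    unfolding disturbance_law_def by (rule measurable_compose[OF measurable_snd])
qed

lemma word_info_disturbance_measurable:
  "(\<lambda>p. word_info N b (received a (fst p) (snd p))) \<in> borel_measurable (disturbance_law X21 N)"
  unfolding word_info_def received_def
  by (intro borel_measurable_sum info_measurable borel_measurable_add borel_measurable_times
      borel_measurable_const disturbance_measurable) auto

lemma word_info_transmission_measurable:
  "(\<lambda>(a, x2, z). word_info N a (received a x2 z)) \<in> borel_measurable (transmission_law N)"
proof -
  have "(\<lambda>p. fst p j) \<in> borel_measurable (transmission_law N)" for j
    unfolding transmission_law_def by (rule measurable_compose[OF measurable_fst]) simp
  moreover have "(\<lambda>p. fst (snd p) j) \<in> borel_measurable (transmission_law N)"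
    "(\<lambda>p. snd (snd p) j) \<in> borel_measurable (transmission_law N)" if "j < N" for j
    unfolding transmission_law_def
    by (rule measurable_compose[OF measurable_snd], rule disturbance_measurable[OF that])+
  ultimately show ?thesis
    unfolding word_info_def received_def case_prod_unfold
    by (intro borel_measurable_sum info_measurable borel_measurable_add borel_measurable_times
        borel_measurable_const) auto
qed

lemma prob_space_words_disturbance:
  "prob_space (\<Pi>\<^sub>M j\<in>{..<N::nat}. measure_pmf (pmf_of_set X21))"
  "prob_space (\<Pi>\<^sub>M j\<in>{..<N::nat}. CN01)"
  by (intro prob_space_PiM prob_space_measure_pmf prob_space_CN01)+

lemma prob_space_disturbance_law: "prob_space (disturbance_law X21 N)"
proof -
  interpret A: prob_space "\<Pi>\<^sub>M j\<in>{..<N}. measure_pmf (pmf_of_set X21)" by (rule prob_space_words_disturbance)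
  interpret B: prob_space "\<Pi>\<^sub>M j\<in>{..<N}. CN01" by (rule prob_space_words_disturbance)
  interpret P: pair_prob_space "\<Pi>\<^sub>M j\<in>{..<N}. measure_pmf (pmf_of_set X21)" "\<Pi>\<^sub>M j\<in>{..<N}. CN01" ..
  show ?thesis unfolding disturbance_law_def by unfold_locales
qed

lemma prob_space_transmission_law: "prob_space (transmission_law N)"
proof -
  interpret D: prob_space "disturbance_law X21 N" by (rule prob_space_disturbance_law)
  interpret P: pair_prob_space "measure_pmf (pmf_of_set (words N))" "disturbance_law X21 N" ..
  show ?thesis unfolding transmission_law_def by unfold_locales
qed

lemma measure_transmission_law:
  "measure (transmission_law N) {(a, x2, z) \<in> space (transmission_law N). word_info N a (received a x2 z) \<le> L}
    = 1 / real (card (words N)) *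
      (\<Sum>a\<in>words N. measure (disturbance_law X21 N)
        {p \<in> space (disturbance_law X21 N). word_info N a (received a (fst p) (snd p)) \<le> L})"
proof -
  let ?D = "disturbance_law X21 N" and ?T = "transmission_law N"
  define E where "E = {(a, x2, z) \<in> space ?T. word_info N a (received a x2 z) \<le> L}"
  let ?f = "\<lambda>(a, x2, z). word_info N a (received a x2 z)"
  interpret D: prob_space ?D by (rule prob_space_disturbance_law)
  interpret T: prob_space ?T by (rule prob_space_transmission_law)
  have E: "E = ?f -` {..L} \<inter> space ?T" by (auto simp: E_def)
  have Es: "E \<in> sets ?T"
    unfolding E by (rule measurable_sets[OF word_info_transmission_measurable]) simp
  have ind: "(\<lambda>p. indicator E (a, p) :: real)
    = indicator ({p. word_info N a (received a (fst p) (snd p)) \<le> L} \<inter> space ?D)" if "a \<in> words N" for a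
    by (auto simp: fun_eq_iff E_def transmission_law_def space_pair_measure split: split_indicator)
  have sD: "{p \<in> space ?D. word_info N a (received a (fst p) (snd p)) \<le> L} \<in> sets ?D" for a
    using measurable_sets[OF word_info_disturbance_measurable, of "{..L}" N a a]
    by (simp add: vimage_def Int_def conj_commute)
  have m: "indicator E \<in> borel_measurable (measure_pmf (pmf_of_set (words N)) \<Otimes>\<^sub>M ?D)"
    using Es unfolding transmission_law_def by (intro borel_measurable_indicator)
  have "measure ?T E = (LINT p|?T. indicator E p)"
    using Es by (simp add: Int_absorb2 sets.sets_into_space)
  also have "\<dots> = (1 / real (card (words N))) *\<^sub>R (\<Sum>a\<in>words N. LINT p|?D. indicator E (a, p))"
    unfolding transmission_law_def[of N]
  proof (rule pmf_of_set_pair_integral(2)[OF words(1,2) prob_space_disturbance_law m])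
    fix a assume a: "a \<in> words N"
    show "integrable ?D (\<lambda>p. indicator E (a, p) :: real)"
      unfolding ind[OF a]
      by (intro integrable_real_indicator) (use sD in \<open>simp_all add: Int_def conj_commute D.emeasure_eq_measure\<close>)
  qed
  also have "(\<Sum>a\<in>words N. LINT p|?D. indicator E (a, p))
    = (\<Sum>a\<in>words N. measure ?D {p \<in> space ?D. word_info N a (received a (fst p) (snd p)) \<le> L})"
    by (intro sum.cong refl) (simp add: ind Int_def conj_commute)
  finally show ?thesis by (simp add: E_def)
qed

text \<open>The disturbance is a pair of words, not a word of pairs. Fubini fixes the interference
  word, the noise integral factorises over positions, and then so does the interference
  average.\<close>

lemma integral_disturbance_prod:
  fixes g :: "nat \<Rightarrow> complex \<Rightarrow> complex \<Rightarrow> complex"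
  assumes [measurable]: "\<And>j x. g j x \<in> borel_measurable borel"
    and meas: "\<And>j. j < N \<Longrightarrow> (\<lambda>p. g j (fst p j) (snd p j)) \<in> borel_measurable (disturbance_law X21 N)"
    and bnd: "\<And>j x z. cmod (g j x z) \<le> 1"
  shows "(\<integral>p. (\<Prod>j<N. g j (fst p j) (snd p j)) \<partial>disturbance_law X21 N)
    = (\<Prod>j<N. 1 / real (card X21) * (\<Sum>x\<in>X21. \<integral>z. g j x z \<partial>CN01))"
proof -
  let ?A = "\<Pi>\<^sub>M j\<in>{..<N}. measure_pmf (pmf_of_set X21)" and ?B = "\<Pi>\<^sub>M j\<in>{..<N}. CN01"
  interpret C: prob_space CN01 by (rule prob_space_CN01)
  interpret A: prob_space ?A by (rule prob_space_words_disturbance)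
  interpret B: prob_space ?B by (rule prob_space_words_disturbance)
  interpret P: pair_prob_space ?A ?B ..
  interpret PA: product_sigma_finite "\<lambda>_::nat. measure_pmf (pmf_of_set X21)" ..
  interpret PB: product_sigma_finite "\<lambda>_::nat. CN01" ..
  have i: "integrable (?A \<Otimes>\<^sub>M ?B) (\<lambda>p. \<Prod>j<N. g j (fst p j) (snd p j))"
  proof (rule P.integrable_const_bound)
    show "AE p in ?A \<Otimes>\<^sub>M ?B. norm (\<Prod>j<N. g j (fst p j) (snd p j)) \<le> 1"
      by (intro AE_I2) (simp add: prod_norm[symmetric] prod_le_1 bnd)
    show "(\<lambda>p. \<Prod>j<N. g j (fst p j) (snd p j)) \<in> borel_measurable (?A \<Otimes>\<^sub>M ?B)"
      using meas unfolding disturbance_law_def by (intro borel_measurable_prod) auto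
  qed
  have gz: "integrable CN01 (g j x)" for j x
    by (rule C.integrable_const_bound[of _ 1]) (auto simp: bnd)
  have "(\<integral>p. (\<Prod>j<N. g j (fst p j) (snd p j)) \<partial>disturbance_law X21 N)
    = (\<integral>x. (\<integral>z. (\<Prod>j<N. g j (x j) (z j)) \<partial>?B) \<partial>?A)"
    unfolding disturbance_law_def using P.integral_fst'[OF i] by simp
  also have "\<dots> = (\<integral>x. (\<Prod>j<N. \<integral>z. g j (x j) z \<partial>CN01) \<partial>?A)"
    by (intro Bochner_Integration.integral_cong refl PB.product_integral_prod gz) auto
  also have "\<dots> = (\<Prod>j<N. \<integral>x. (\<integral>z. g j x z \<partial>CN01) \<partial>measure_pmf (pmf_of_set X21))"
    using X21 by (intro PA.product_integral_prod integrable_measure_pmf_finite) auto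
  also have "\<dots> = (\<Prod>j<N. 1 / real (card X21) * (\<Sum>x\<in>X21. \<integral>z. g j x z \<partial>CN01))"
  proof (intro prod.cong refl)
    fix j
    have "(\<integral>x. (\<integral>z. g j x z \<partial>CN01) \<partial>measure_pmf (pmf_of_set X21))
      = (\<Sum>x\<in>X21. pmf (pmf_of_set X21) x *\<^sub>R (\<integral>z. g j x z \<partial>CN01))"
      using X21 by (intro integral_measure_pmf) (auto simp: set_pmf_of_set)
    then show "(\<integral>x. (\<integral>z. g j x z \<partial>CN01) \<partial>measure_pmf (pmf_of_set X21))
      = 1 / real (card X21) * (\<Sum>x\<in>X21. \<integral>z. g j x z \<partial>CN01)"
      using X21 by (simp add: indicator_def scaleR_conv_of_real sum_divide_distrib)
  qed
  finally show ?thesis .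
qed

definition word_info_law :: "nat \<Rightarrow> real measure" where
  "word_info_law N = distr (transmission_law N) borel (\<lambda>(a, x2, z). word_info N a (received a x2 z) - real N * MI)"

lemma word_info_centered_measurable [measurable]:
  "(\<lambda>(a, x2, z). word_info N a (received a x2 z) - real N * MI) \<in> borel_measurable (transmission_law N)"
proof -
  have "(\<lambda>p. (\<lambda>(a, x2, z). word_info N a (received a x2 z)) p - real N * MI) \<in> borel_measurable (transmission_law N)"
    using word_info_transmission_measurable by (intro borel_measurable_diff) auto
  then show ?thesis by (simp add: case_prod_unfold)
qed

lemma real_distribution_word_info_law: "real_distribution (word_info_law N)"
  unfolding word_info_law_def
  by (rule prob_space.real_distribution_distr[OF prob_space_transmission_law]) simp

text \<open>This carries the independence of the symbols: for a fixed word the disturbance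
  factorises over positions, and the average over all words factorises by exchanging sum and
  product. In this form it matches the hypothesis of \<open>berry_esseen_log\<close>.\<close>

lemma char_word_info_law: "char (word_info_law N) t = char symbol_info_law t ^ N"
proof -
  let ?D = "disturbance_law X21 N" and ?T = "transmission_law N"
  interpret D: prob_space ?D by (rule prob_space_disturbance_law)
  interpret C: prob_space CN01 by (rule prob_space_CN01)
  define g where "g x1 x2 z = iexp (t * (info x1 (h * (x1 + x2) + z) - MI))" for x1 x2 z
  have g1: "cmod (g x1 x2 z) = 1" for x1 x2 z
    unfolding g_def by (simp only: norm_exp_i_times)
  have gm [measurable]: "g x1 x2 \<in> borel_measurable borel" for x1 x2
    unfolding g_def by measurable
  have gD: "(\<lambda>p. g (a j) (fst p j) (snd p j)) \<in> borel_measurable ?D" if "j < N" for a :: "nat \<Rightarrow> complex" and j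
  proof -
    have "(\<lambda>p. info (a j) (h * (a j + fst p j) + snd p j)) \<in> borel_measurable ?D"
      by (intro info_measurable borel_measurable_add borel_measurable_times
          borel_measurable_const disturbance_measurable that)
    then show ?thesis unfolding g_def by measurable
  qed
  \<comment> \<open>The characteristic function of one centred symbol conditioned on the input
    \<open>x1\<close>.\<close>
  define H where "H x1 = 1 / of_nat (card X21) * (\<Sum>x2\<in>X21. \<integral>z. g x1 x2 z \<partial>CN01)" for x1
  have exp_prod: "iexp (t * (word_info N a (received a x2 z) - real N * MI)) = (\<Prod>j<N. g (a j) (x2 j) (z j))"
    for a x2 z
  proof -
    have "word_info N a (received a x2 z) - real N * MI = (\<Sum>j<N. info (a j) (h * (a j + x2 j) + z j) - MI)"
      by (simp add: word_info_def received_def sum_subtractf)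
    then show ?thesis
      by (simp add: g_def exp_sum[symmetric] sum_distrib_left of_real_sum)
  qed
  have "char (word_info_law N) t
    = (CLINT p|?T. iexp (t * (\<lambda>(a, x2, z). word_info N a (received a x2 z) - real N * MI) p))"
    unfolding char_def word_info_law_def
    by (subst integral_distr[OF word_info_centered_measurable]) auto
  also have "\<dots> = (CLINT p|?T. (\<lambda>(a, x2, z). \<Prod>j<N. g (a j) (x2 j) (z j)) p)"
    by (intro Bochner_Integration.integral_cong refl) (simp only: case_prod_unfold exp_prod)
  also have "\<dots> = (1 / real (card (words N))) *\<^sub>R
    (\<Sum>a\<in>words N. CLINT p|?D. (\<lambda>(a, x2, z). \<Prod>j<N. g (a j) (x2 j) (z j)) (a, p))"
    unfolding transmission_law_def
  proof (rule pmf_of_set_pair_integral(2)[OF words(1,2) prob_space_disturbance_law])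
    have "(\<lambda>p. iexp (t * (\<lambda>(a, x2, z). word_info N a (received a x2 z) - real N * MI) p)) \<in> borel_measurable ?T"
      by measurable
    also have "(\<lambda>p. iexp (t * (\<lambda>(a, x2, z). word_info N a (received a x2 z) - real N * MI) p))
      = (\<lambda>(a, x2, z). \<Prod>j<N. g (a j) (x2 j) (z j))"
      by (simp only: case_prod_unfold exp_prod)
    finally show "(\<lambda>(a, x2, z). \<Prod>j<N. g (a j) (x2 j) (z j))
      \<in> borel_measurable (measure_pmf (pmf_of_set (words N)) \<Otimes>\<^sub>M ?D)"
      unfolding transmission_law_def .
  next
    fix a
    show "integrable ?D (\<lambda>p. (\<lambda>(a, x2, z). \<Prod>j<N. g (a j) (x2 j) (z j)) (a, p))"
      by (rule D.integrable_const_bound[of _ 1])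
        (auto simp: case_prod_unfold prod_norm[symmetric] g1 intro!: borel_measurable_prod gD)
  qed
  also have "(\<Sum>a\<in>words N. CLINT p|?D. (\<lambda>(a, x2, z). \<Prod>j<N. g (a j) (x2 j) (z j)) (a, p))
    = (\<Sum>a\<in>words N. \<Prod>j<N. H (a j))"
  proof (intro sum.cong refl)
    fix a
    show "(CLINT p|?D. (\<lambda>(a, x2, z). \<Prod>j<N. g (a j) (x2 j) (z j)) (a, p)) = (\<Prod>j<N. H (a j))"
      using integral_disturbance_prod[of "\<lambda>j. g (a j)" N] gD g1
      by (simp add: case_prod_unfold H_def)
  qed
  also have "\<dots> = (\<Prod>j<N. \<Sum>x\<in>X1. H x)"
    unfolding words_def using X1 by (subst prod_sum_PiE) auto
  finally have lhs: "char (word_info_law N) t = ((\<Sum>x\<in>X1. H x) / of_nat (card X1)) ^ N"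
    by (simp add: words scaleR_conv_of_real power_divide)
  have "char symbol_info_law t = (CLINT p|symbol_law X1 X21. (\<lambda>(x1, x2, z). g x1 x2 z) p)"
    unfolding char_def symbol_info_law_def
    by (subst integral_distr[OF symbol_info_measurable])
      (auto simp: g_def symbol_info_def case_prod_unfold)
  also have "\<dots> = (1 / (real (card X1) * real (card X21))) *\<^sub>R
    (\<Sum>x1\<in>X1. \<Sum>x2\<in>X21. \<integral>z. (\<lambda>(x1, x2, z). g x1 x2 z) (x1, x2, z) \<partial>CN01)"
  proof (rule integral_symbol_law)
    have "(\<lambda>p. iexp (t * symbol_info p)) \<in> borel_measurable (symbol_law X1 X21)" by measurable
    then show "(\<lambda>(x1, x2, z). g x1 x2 z) \<in> borel_measurable (symbol_law X1 X21)"
      by (simp add: g_def symbol_info_def case_prod_unfold)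
    show "integrable CN01 (\<lambda>z. (\<lambda>(x1, x2, z). g x1 x2 z) (x1, x2, z))" for x1 x2
      by (rule C.integrable_const_bound[of _ 1]) (auto simp: g1)
  qed
  also have "\<dots> = (\<Sum>x\<in>X1. H x) / of_nat (card X1)"
    by (simp add: H_def scaleR_conv_of_real sum_divide_distrib[symmetric])
  finally show ?thesis using lhs by simp
qed

section \<open>Random coding\<close>

text \<open>A union bound for one fixed codebook. Each probability involves at most two codewords,
  so the later average over codebooks is a manipulation of finite sums.\<close>

lemma tin_error_le:
  fixes L :: real and N :: nat
  defines "D \<equiv> disturbance_law X21 N"
  defines "low \<equiv> \<lambda>a. measure D {p \<in> space D. word_info N a (received a (fst p) (snd p)) \<le> L}"
    and "high \<equiv> \<lambda>a b. measure D {p \<in> space D. L < word_info N b (received a (fst p) (snd p))}"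
  shows "tin_error h X21 N M c \<le> 1 / real M * (\<Sum>w<M. low (c w) + (\<Sum>w'\<in>{..<M} - {w}. high (c w) (c w')))"
  unfolding tin_error_def
proof (intro mult_left_mono sum_mono)
  interpret D: prob_space D unfolding D_def by (rule prob_space_disturbance_law)
  fix w assume "w \<in> {..<M}"
  then have w: "w < M" by simp
  let ?L = "{p \<in> space D. word_info N (c w) (received (c w) (fst p) (snd p)) \<le> L}"
  let ?H = "\<lambda>w'. {p \<in> space D. L < word_info N (c w') (received (c w) (fst p) (snd p))}"
  note m = word_info_disturbance_measurable[of N, folded D_def]
  have L: "?L \<in> sets D" using borel_measurable_le[OF m borel_measurable_const] by simp
  have H: "?H w' \<in> sets D" for w' using borel_measurable_less[OF borel_measurable_const m] by simp
  have "\<P>((x2, z) in D. tin_decode h X21 N M c (\<lambda>j. h * (c w j + x2 j) + z j) \<noteq> w)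
    \<le> measure D (?L \<union> (\<Union>w'\<in>{..<M} - {w}. ?H w'))"
  proof (rule D.finite_measure_mono)
    show "{(x2, z) \<in> space D. tin_decode h X21 N M c (\<lambda>j. h * (c w j + x2 j) + z j) \<noteq> w}
      \<subseteq> ?L \<union> (\<Union>w'\<in>{..<M} - {w}. ?H w')"
    proof
      fix p
      assume p: "p \<in> {(x2, z) \<in> space D. tin_decode h X21 N M c (\<lambda>j. h * (c w j + x2 j) + z j) \<noteq> w}"
      then have "tin_decode h X21 N M c (received (c w) (fst p) (snd p)) \<noteq> w"
        by (auto simp: received_def)
      from tin_decode_error[OF w this, of L] p
      show "p \<in> ?L \<union> (\<Union>w'\<in>{..<M} - {w}. ?H w')" by auto
    qed
    show "?L \<union> (\<Union>w'\<in>{..<M} - {w}. ?H w') \<in> sets D" using L H by auto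
  qed
  also have "\<dots> \<le> measure D ?L + measure D (\<Union>w'\<in>{..<M} - {w}. ?H w')"
    by (intro measure_Un_le L sets.finite_UN H) auto
  also have "measure D (\<Union>w'\<in>{..<M} - {w}. ?H w') \<le> (\<Sum>w'\<in>{..<M} - {w}. measure D (?H w'))"
    by (intro measure_UNION_le H) auto
  finally show "\<P>((x2, z) in disturbance_law X21 N. tin_decode h X21 N M c (\<lambda>j. h * (c w j + x2 j) + z j) \<noteq> w)
      \<le> low (c w) + (\<Sum>w'\<in>{..<M} - {w}. high (c w) (c w'))"
    by (simp add: low_def high_def D_def)
qed simp

text \<open>Markov's inequality in the form indicator (L < i) \<le> 2 powr (i - L), summed over
  \<open>b\<close> for each disturbance separately. The transmitted word \<open>a\<close> is fixed
  while \<open>b\<close> runs over all words, which models an independent competitor.\<close>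

lemma sum_high_le:
  fixes L :: real and N :: nat
  defines "D \<equiv> disturbance_law X21 N"
  shows "(\<Sum>b\<in>words N. measure D {p \<in> space D. L < word_info N b (received a (fst p) (snd p))})
    \<le> real (card (words N)) * 2 powr - L"
proof -
  interpret D: prob_space D unfolding D_def by (rule prob_space_disturbance_law)
  let ?H = "\<lambda>b. {p \<in> space D. L < word_info N b (received a (fst p) (snd p))}"
  note m = word_info_disturbance_measurable[of N, folded D_def]
  have H: "?H b \<in> sets D" for b using borel_measurable_less[OF borel_measurable_const m] by simp
  have i: "integrable D (indicator (?H b) :: _ \<Rightarrow> real)" for b
    using H by (intro integrable_real_indicator) (auto simp: D.emeasure_eq_measure)
  have "(\<Sum>b\<in>words N. measure D (?H b)) = (LINT p|D. (\<Sum>b\<in>words N. indicator (?H b) p))"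
    using H i by (subst Bochner_Integration.integral_sum) (auto simp: Int_absorb2 sets.sets_into_space)
  also have "\<dots> \<le> (LINT p|D. real (card (words N)) * 2 powr - L)"
  proof (intro integral_mono Bochner_Integration.integrable_sum i)
    fix p
    let ?y = "received a (fst p) (snd p)"
    have "(\<Sum>b\<in>words N. indicator (?H b) p) \<le> (\<Sum>b\<in>words N. 2 powr word_info N b ?y * 2 powr - L)"
    proof (intro sum_mono)
      fix b
      show "(indicator (?H b) p :: real) \<le> 2 powr word_info N b ?y * 2 powr - L"
        unfolding powr_add[symmetric] using ge_one_powr_ge_zero[of 2 "word_info N b ?y - L"]
        by (auto split: split_indicator)
    qed
    then show "(\<Sum>b\<in>words N. indicator (?H b) p) \<le> real (card (words N)) * 2 powr - L"
      by (simp add: sum_distrib_right[symmetric] sum_powr_word_info)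
  qed simp
  finally show ?thesis by (simp add: D.prob_space)
qed

text \<open>The decoder does not involve \<open>L\<close>; the threshold belongs to the analysis and
  may be chosen freely afterwards.\<close>

lemma random_coding_bound:
  assumes "M \<ge> 1"
  shows "measure_pmf.expectation (pmf_of_set (codebooks X1 N M)) (tin_error h X21 N M)
    \<le> cdf (word_info_law N) (L - real N * MI) + real M * 2 powr - L"
proof -
  let ?D = "disturbance_law X21 N" and ?T = "transmission_law N"
  define low where "low a = measure ?D {p \<in> space ?D. word_info N a (received a (fst p) (snd p)) \<le> L}" for a
  define high where "high a b = measure ?D {p \<in> space ?D. L < word_info N b (received a (fst p) (snd p))}" for a b
  let ?A = "words N" and ?C = "codebooks X1 N M"
  have C: "?C = {..<M} \<rightarrow>\<^sub>E ?A" by (simp add: codebooks_def words_def)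
  have Cf: "finite ?C" "?C \<noteq> {}" unfolding C using words by (auto simp: finite_PiE PiE_eq_empty_iff)
  then have cC: "real (card ?C) > 0" by (simp add: card_gt_0_iff)
  have cA: "real (card ?A) > 0" using words(1,2)[of N] by (simp add: card_gt_0_iff)
  define P where "P = cdf (word_info_law N) (L - real N * MI)"
  have P: "P = 1 / real (card ?A) * (\<Sum>a\<in>?A. low a)"
  proof -
    have "P = measure ?T {(a, x2, z) \<in> space ?T. word_info N a (received a x2 z) \<le> L}"
      unfolding P_def cdf_def word_info_law_def
      by (subst measure_distr[OF word_info_centered_measurable])
        (auto intro!: arg_cong[where f = "measure ?T"])
    then show ?thesis by (simp add: measure_transmission_law low_def)
  qed
  have sum_low: "(\<Sum>c\<in>?C. low (c w)) = real (card ?C) * P" if "w < M" for w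
  proof -
    have "real (card ?A) * (\<Sum>c\<in>?C. low (c w)) = (\<Sum>c\<in>?C. \<Sum>b\<in>?A. low ((c(w := b)) w))"
      unfolding C using that by (intro sum_PiE_resample[symmetric]) simp
    also have "\<dots> = real (card ?C) * (\<Sum>b\<in>?A. low b)" by simp
    finally show ?thesis using cA by (simp add: P field_simps)
  qed
  \<comment> \<open>Since \<open>w'\<close> differs from \<open>w\<close>, redrawing codeword
    \<open>w'\<close> leaves the transmitted codeword, and hence the received word,
    unchanged.\<close>
  have sum_high: "(\<Sum>c\<in>?C. high (c w) (c w')) \<le> real (card ?C) * 2 powr - L" if "w' < M" "w' \<noteq> w" for w w'
  proof -
    have "real (card ?A) * (\<Sum>c\<in>?C. high (c w) (c w'))
      = (\<Sum>c\<in>?C. \<Sum>b\<in>?A. high ((c(w' := b)) w) ((c(w' := b)) w'))"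
      unfolding C using that by (intro sum_PiE_resample[symmetric]) simp
    also have "\<dots> = (\<Sum>c\<in>?C. \<Sum>b\<in>?A. high (c w) b)" using that by simp
    also have "\<dots> \<le> (\<Sum>c\<in>?C. real (card ?A) * 2 powr - L)"
      unfolding high_def by (intro sum_mono sum_high_le)
    also have "\<dots> = real (card ?A) * (real (card ?C) * 2 powr - L)" by simp
    finally show ?thesis using cA by simp
  qed
  have "(\<Sum>c\<in>?C. tin_error h X21 N M c)
    \<le> (\<Sum>c\<in>?C. 1 / real M * (\<Sum>w<M. low (c w) + (\<Sum>w'\<in>{..<M} - {w}. high (c w) (c w'))))"
    unfolding low_def high_def by (intro sum_mono tin_error_le)
  also have "\<dots> = 1 / real M * (\<Sum>w<M. (\<Sum>c\<in>?C. low (c w)) + (\<Sum>w'\<in>{..<M} - {w}. \<Sum>c\<in>?C. high (c w) (c w')))"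
    unfolding sum_distrib_left[symmetric]
    by (subst sum.swap) (simp add: sum.distrib sum.swap[of _ ?C])
  also have "\<dots> \<le> 1 / real M * (\<Sum>w<M. real (card ?C) * P + (\<Sum>w'\<in>{..<M} - {w}. real (card ?C) * 2 powr - L))"
    by (intro mult_left_mono sum_mono add_mono sum_high) (auto simp: sum_low)
  also have "\<dots> \<le> 1 / real M * (\<Sum>w<M. real (card ?C) * P + real M * (real (card ?C) * 2 powr - L))"
  proof (intro mult_left_mono sum_mono add_left_mono)
    fix w
    \<comment> \<open>M - 1 competitors are counted as M.\<close>
    have "(\<Sum>w'\<in>{..<M} - {w}. real (card ?C) * 2 powr - L) \<le> (\<Sum>w'<M. real (card ?C) * 2 powr - L)"
      by (rule sum_mono2) auto
    then show "(\<Sum>w'\<in>{..<M} - {w}. real (card ?C) * 2 powr - L) \<le> real M * (real (card ?C) * 2 powr - L)"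
      by simp
  qed simp
  also have "\<dots> = real (card ?C) * (P + real M * 2 powr - L)"
    using assms by (simp add: algebra_simps)
  finally have "(\<Sum>c\<in>?C. tin_error h X21 N M c) / real (card ?C) \<le> P + real M * 2 powr - L"
    using cC by (simp add: pos_divide_le_eq mult.commute)
  then show ?thesis
    using Cf by (simp add: integral_pmf_of_set P_def)
qed

text \<open>The term log N / 2 in the threshold makes the competitor term exactly 1 / sqrt N, and
  costs log N / (2 N) in rate.\<close>

lemma tin_achievable_if:
  assumes "M \<ge> 1" "N \<ge> 1"
    and "cdf (word_info_law N) (log 2 M + log 2 N / 2 - real N * MI) + 1 / sqrt N \<le> e"
  shows "tin_achievable h X1 X21 N M e"
proof -
  let ?L = "log 2 M + log 2 N / 2"
  have "2 powr (log 2 N / 2) = (2 powr log 2 N) powr (1 / 2)"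
    by (simp only: powr_powr) simp
  also have "\<dots> = sqrt N" using assms by (simp add: powr_half_sqrt)
  finally have "2 powr ?L = real M * sqrt N" using assms by (simp add: powr_add)
  then have "real M * 2 powr - ?L = 1 / sqrt N"
    using assms by (simp add: powr_minus field_simps)
  then show ?thesis
    unfolding tin_achievable_def using random_coding_bound[OF assms(1), of N ?L] assms(3) by linarith
qed

section \<open>Second-order asymptotics of the rate\<close>

lemma dispersion_nonneg: "dispersion h X1 X21 \<ge> 0"
  unfolding dispersion_def by (intro Bochner_Integration.integral_nonneg) auto

text \<open>The centred information density vanishes almost surely, so the characteristic function
  of the word law is 1 and the law is the point mass at 0.\<close>

lemma cdf_word_info_law_zero_dispersion:
  assumes "dispersion h X1 X21 = 0" and "u < 0"
  shows "cdf (word_info_law N) u = 0"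
proof -
  interpret S: real_distribution symbol_info_law by (rule real_distribution_symbol_info_law)
  have "AE x in symbol_info_law. x\<^sup>2 = 0"
    using symbol_info_law_moments(3,4) assms by (subst integral_nonneg_eq_0_iff_AE[symmetric]) auto
  then have ae: "AE x in symbol_info_law. x = 0" by simp
  have "char symbol_info_law t = 1" for t
  proof -
    have "char symbol_info_law t = (CLINT x|symbol_info_law. 1)"
      unfolding char_def by (intro integral_cong_AE) (use ae in auto)
    then show ?thesis using S.prob_space by simp
  qed
  then have c: "char (word_info_law N) = (\<lambda>_. 1)" by (simp add: fun_eq_iff char_word_info_law)
  have r: "real_distribution (return borel 0)"
    by (intro real_distribution.intro prob_space_return real_distribution_axioms.intro) auto
  have "word_info_law N = return borel 0"
    by (rule Levy_uniqueness[OF real_distribution_word_info_law r])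
      (simp add: c char_def integral_return fun_eq_iff)
  then show ?thesis using assms by (simp add: cdf_def measure_return)
qed

text \<open>Backing off in rate by \<open>C * log N / N\<close> lowers the normal argument enough to
  pay for the approximation error and for 1 / sqrt N.\<close>

lemma eventually_achievable:
  assumes e: "0 < e" "e < 1"
  shows "\<exists>C n0. \<forall>N\<ge>n0. \<forall>M\<ge>1.
    log 2 (real M) / real N \<le> MI - sqrt (dispersion h X1 X21 / real N) * Qinv e - C * (log 2 (real N) / real N)
    \<longrightarrow> tin_achievable h X1 X21 N M e"
proof -
  define V where "V = dispersion h X1 X21"
  define q where "q = Qinv e"
  let ?\<Phi> = "cdf std_normal_distribution"
  interpret \<Phi>: real_distribution std_normal_distribution by (rule real_dist_normal_dist)
  have slack: "log 2 M + log 2 N / 2 - real N * MI \<le> - sqrt (N * V) * q - (C - 1 / 2) * log 2 N"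
    if "N \<ge> 1" "log 2 (real M) / real N \<le> MI - sqrt (V / real N) * q - C * (log 2 (real N) / real N)"
    for C M and N :: nat
  proof -
    have N: "real N > 0" using that by simp
    have "log 2 (real M) \<le> real N * (MI - sqrt (V / real N) * q - C * (log 2 (real N) / real N))"
      using that(2) N by (simp add: pos_divide_le_eq mult.commute)
    also have "\<dots> = real N * MI - (real N * sqrt (V / real N)) * q - C * log 2 N"
      using N by (simp add: algebra_simps)
    also have "real N * sqrt (V / real N) = sqrt (N * V)"
      using N by (simp add: real_sqrt_divide real_sqrt_mult field_simps)
    finally show ?thesis by (simp add: algebra_simps)
  qed
  show ?thesis
  proof (cases "V = 0")
    case True
    \<comment> \<open>From here on 1 / sqrt N \<le> e, which is the whole error: with C = 1 the
      argument of the distribution function is at most - log N / 2, strictly below the point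
      mass.\<close>
    obtain n1 :: nat where n1: "1 / e\<^sup>2 \<le> n1" using real_arch_simple by blast
    show ?thesis
    proof (rule exI[of _ 1], rule exI[of _ "max 2 n1"], intro allI impI)
      fix N M :: nat
      assume N: "max 2 n1 \<le> N" and M: "1 \<le> M"
        and "log 2 (real M) / real N \<le> MI - sqrt (dispersion h X1 X21 / real N) * Qinv e - 1 * (log 2 (real N) / real N)"
      then have "log 2 M + log 2 N / 2 - real N * MI \<le> - sqrt (N * V) * q - (1 - 1 / 2) * log 2 N"
        by (intro slack) (auto simp: V_def q_def)
      moreover have "log 2 N > 0" using N by simp
      ultimately have neg: "log 2 M + log 2 N / 2 - real N * MI < 0" using True by simp
      have "1 / e\<^sup>2 \<le> real N" using n1 N by linarith
      then have "sqrt (1 / e\<^sup>2) \<le> sqrt N" by (rule real_sqrt_le_mono)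
      then have "1 / sqrt N \<le> e" using e N by (simp add: real_sqrt_divide field_simps)
      then show "tin_achievable h X1 X21 N M e"
        using M N neg True by (intro tin_achievable_if) (auto simp: cdf_word_info_law_zero_dispersion V_def)
    qed
  next
    case False
    then have V: "V > 0" using dispersion_nonneg by (simp add: V_def)
    obtain C where BE: "\<And>n N x. n \<ge> 2 \<Longrightarrow> real_distribution N \<Longrightarrow> (\<And>t. char N t = char symbol_info_law t ^ n)
      \<Longrightarrow> cdf N x \<le> ?\<Phi> (x / sqrt (n * V)) + C * (ln n / sqrt n)"
      using berry_esseen_log[OF real_distribution_symbol_info_law symbol_info_law_moments(1-3)] V
      unfolding V_def by blast
    \<comment> \<open>The extra 1 keeps the shifted point - q - \<open>\<kappa>\<close> * l inside
      [-R, R] once \<open>\<kappa>\<close> * l \<le> 1. In \<open>\<kappa>\<close> the summand |C|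
      pays for the normal approximation and 2 for 1 / sqrt N \<le> 2 * l; the division by the
      density converts probability into displacement.\<close>
    define R where "R = \<bar>q\<bar> + 1"
    define \<kappa> where "\<kappa> = (\<bar>C\<bar> + 2) / std_normal_density R"
    have R: "std_normal_density R > 0" by (simp add: normal_density_pos)
    have \<kappa>: "\<kappa> > 0" using R by (auto simp: \<kappa>_def intro!: divide_pos_pos)
    \<comment> \<open>1 / 2 offsets the term in the threshold; the rest is \<open>\<kappa>\<close> *
      l rescaled by sqrt (N * V), with ln 2 converting natural to binary logarithms.\<close>
    define C' where "C' = 1 / 2 + ln 2 * sqrt V * \<kappa>"
    have "(\<lambda>n. ln (real n) / real n powr (1 / 2)) \<longlonglongrightarrow> 0"
      by (rule lim_ln_over_power) simp
    then have "eventually (\<lambda>n. ln (real n) / real n powr (1 / 2) < 1 / \<kappa>) sequentially"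
      using \<kappa> by (intro order_tendstoD(2)) auto
    then obtain n1 where n1: "\<And>n. n \<ge> n1 \<Longrightarrow> ln (real n) / real n powr (1 / 2) < 1 / \<kappa>"
      by (auto simp: eventually_sequentially)
    show ?thesis
    proof (rule exI[of _ C'], rule exI[of _ "max 2 n1"], intro allI impI)
      fix N M :: nat
      assume N: "max 2 n1 \<le> N" and M: "1 \<le> M"
        and rate: "log 2 (real M) / real N \<le> MI - sqrt (dispersion h X1 X21 / real N) * Qinv e - C' * (log 2 (real N) / real N)"
      have N2: "N \<ge> 2" "real N > 0" using N by auto
      define l where "l = ln N / sqrt N"
      have ln_half: "ln N \<ge> 1 / 2" using ln_ge_half[OF N2(1)] .
      have l: "l > 0" using N2 by (simp add: l_def)
      have l2: "1 / sqrt N \<le> 2 * l" using ln_half N2 by (simp add: l_def field_simps)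
      have "l < 1 / \<kappa>" using n1[of N] N by (simp add: l_def powr_half_sqrt)
      then have \<kappa>l: "\<kappa> * l \<le> 1" using \<kappa> by (simp add: field_simps)
      define u where "u = log 2 M + log 2 N / 2 - real N * MI"
      have NV: "sqrt (N * V) > 0" using N2 V by simp
      have "u \<le> - sqrt (N * V) * q - (C' - 1 / 2) * log 2 N"
        unfolding u_def by (rule slack) (use rate N2 in \<open>auto simp: V_def q_def\<close>)
      also have "(C' - 1 / 2) * log 2 N = sqrt (N * V) * (\<kappa> * l)"
        using N2 by (simp add: C'_def l_def log_def real_sqrt_mult field_simps)
      finally have "u \<le> (- q - \<kappa> * l) * sqrt (N * V)" by (simp add: algebra_simps)
      then have u: "u / sqrt (N * V) \<le> - q - \<kappa> * l" using NV by (simp add: pos_divide_le_eq)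
      have "cdf (word_info_law N) u \<le> ?\<Phi> (u / sqrt (N * V)) + C * l"
        unfolding l_def using N2 by (intro BE real_distribution_word_info_law char_word_info_law)
      also have "?\<Phi> (u / sqrt (N * V)) \<le> ?\<Phi> (- q - \<kappa> * l)" by (rule \<Phi>.cdf_nondecreasing[OF u])
      finally have A: "cdf (word_info_law N) u \<le> ?\<Phi> (- q - \<kappa> * l) + C * l" by simp
      have "0 \<le> \<kappa> * l" using \<kappa> l by simp
      then have "?\<Phi> (- q - \<kappa> * l) + std_normal_density R * (- q - (- q - \<kappa> * l)) \<le> ?\<Phi> (- q)"
        using \<kappa>l by (intro std_normal_cdf_increase) (auto simp: R_def)
      then have B: "?\<Phi> (- q - \<kappa> * l) + (\<bar>C\<bar> + 2) * l \<le> e"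
        using R cdf_Qinv[OF e] by (simp add: \<kappa>_def q_def)
      have "C * l \<le> \<bar>C\<bar> * l" using l by (intro mult_right_mono) auto
      then have "cdf (word_info_law N) u + 1 / sqrt N \<le> e"
        using A B l2 by (simp add: distrib_right)
      then show "tin_achievable h X1 X21 N M e"
        using M N2 unfolding u_def by (intro tin_achievable_if) auto
    qed
  qed
qed

text \<open>A big-O condition constrains \<open>r\<close> for large N only, which leaves room to
  pass from eventual achievability to a statement for every N \<ge> 1.\<close>

lemma achievable_rate:
  assumes e: "0 < e" "e < 1"
  shows "\<exists>r :: nat \<Rightarrow> real. r \<in> O(\<lambda>N. log 2 (real N) / real N) \<and>
    (\<forall>N M. N \<ge> 1 \<longrightarrow> M \<ge> 1 \<longrightarrow>
      log 2 (real M) / real N \<le> MI - sqrt (dispersion h X1 X21 / real N) * Qinv e + r N \<longrightarrow>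
      tin_achievable h X1 X21 N M e)"
proof -
  obtain C n0 where ach: "\<And>N M. N \<ge> n0 \<Longrightarrow> M \<ge> 1 \<Longrightarrow>
    log 2 (real M) / real N \<le> MI - sqrt (dispersion h X1 X21 / real N) * Qinv e - C * (log 2 (real N) / real N)
    \<Longrightarrow> tin_achievable h X1 X21 N M e"
    using eventually_achievable[OF e] by blast
  let ?s = "\<lambda>N. sqrt (dispersion h X1 X21 / real N) * Qinv e"
  \<comment> \<open>below \<open>n0\<close> the right-hand side is made negative, so no \<open>M \<ge> 1\<close> satisfies the rate condition\<close>
  define r where "r N = (if N \<ge> n0 then - C * (log 2 (real N) / real N) else - \<bar>MI - ?s N\<bar> - 1)" for N
  show ?thesis
  proof (intro exI[of _ r] conjI allI impI)
    show "r \<in> O(\<lambda>N. log 2 (real N) / real N)"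
      by (intro bigoI[of _ "\<bar>C\<bar>"] eventually_sequentiallyI[of n0]) (simp add: r_def abs_mult)
    fix N M :: nat
    assume N: "N \<ge> 1" and M: "M \<ge> 1" and rate: "log 2 (real M) / real N \<le> MI - ?s N + r N"
    show "tin_achievable h X1 X21 N M e"
    proof (cases "N \<ge> n0")
      case True
      then show ?thesis using rate M by (intro ach) (auto simp: r_def)
    next
      case False
      have "log 2 (real M) / real N \<ge> 0" using M N by simp
      moreover have "MI - ?s N + r N < 0" using False by (simp add: r_def)
      ultimately show ?thesis using rate by linarith
    qed
  qed
qed

end

lemma discrete_signaling_channel:
  assumes "discrete_signaling h1 h2 P1 P21 m1 m21 X1 X21"
  shows "tin_channel X1 X21"
proof -
  have "finite \<Lambda> \<and> \<Lambda> \<noteq> {}" if "regular_qam m \<Lambda>" for m \<Lambda>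
    using regular_qam_finite[OF that] regular_qam_card[OF that] by auto
  then show ?thesis
    using assms unfolding discrete_signaling_def Let_def tin_channel_def by auto
qed

text \<open>The rate bound is read as achievability: every codebook size meeting the inequality
  attains error at most \<open>\<epsilon>1\<close>. The remainder \<open>r\<close> is fixed before
  \<open>N1\<close> and \<open>M1\<close>, so one O-term serves all blocklengths for the given
  channel, constellations and error level.\<close>

theorem proposition1:
  fixes h1 h2 :: complex and P1 P21 \<epsilon>1 :: real and m1 m21 :: nat and X1 X21 :: "complex set"
  assumes "P1 \<ge> 0" and "P21 \<ge> 0" and "P1 + P21 > 0"
    and "discrete_signaling h1 h2 P1 P21 m1 m21 X1 X21"
    and "0 < \<epsilon>1" and "\<epsilon>1 < 1"
  shows "(\<exists>r :: nat \<Rightarrow> real. r \<in> O(\<lambda>N. log 2 (real N) / real N) \<and>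
           (\<forall>N1 M1. N1 \<ge> 1 \<longrightarrow> M1 \<ge> 1 \<longrightarrow>
              log 2 (real M1) / real N1
                \<le> mutual_info h1 X1 X21 - sqrt (dispersion h1 X1 X21 / real N1) * Qinv \<epsilon>1 + r N1 \<longrightarrow>
              tin_achievable h1 X1 X21 N1 M1 \<epsilon>1)) \<and>
         mutual_info h1 X1 X21 =
           log 2 (real (card X1)) -
           1 / (real (card X1) * real (card X21)) *
             (\<Sum>x1\<in>X1. \<Sum>x21\<in>X21. LINT z|CN01. log 2 (Lratio h1 X1 X21 x1 x21 z)) \<and>
         dispersion h1 X1 X21 =
           1 / (real (card X1) * real (card X21)) *
             (\<Sum>x1\<in>X1. \<Sum>x21\<in>X21. LINT z|CN01. (log 2 (Lratio h1 X1 X21 x1 x21 z))\<^sup>2) -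
           (1 / (real (card X1) * real (card X21)) *
             (\<Sum>x1\<in>X1. \<Sum>x21\<in>X21. LINT z|CN01. log 2 (Lratio h1 X1 X21 x1 x21 z)))\<^sup>2"
proof -
  interpret tin_channel h1 X1 X21
    by (rule discrete_signaling_channel[OF assms(4)])
  show ?thesis
    using achievable_rate[OF assms(5,6)] mutual_info_eq dispersion_eq
    unfolding avg_def by blast
qed

end
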